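(* Let $\alpha\ge 0$ and let $\{B_n\}_{n\ge 0}$ be a monic orthogonal polynomial sequence with respect to $u_0$. If the corresponding $KL_\alpha$-transformed sequence $\{S_n\}_{n\ge 0}$, defined by $S_n(\tau^2/4)=KL_\alpha[B_n](\tau)$, $n\ge 0$, is a monic $d$-orthogonal polynomial sequence, then $d$ must be an even integer greater than or equal to $2$, and $\{B_n\}_{n\ge0}$ is necessarily a semiclassical sequence of class $s\in\{\max(0,d/2-2),\,d/2-1,\,d/2\}$. The corresponding regular form $u_0$ fulfills $$D(\phi u_0)+\psi u_0=0$$ with $(\phi,\psi)$ a pair of admissible polynomials given by one of the following expressions: (a) $\phi(x)=x^2$ and $\psi(x)=x\left(N\rho(x)-(3+2\alpha)\right)$, with $\rho(0)=0$, $\langle u_0,\rho(x)\rangle\neq N^{-1}(2+2\alpha)$ and $\alpha\neq-\frac{n+3}{2}$, $n\in\mathbb{N}_0$ ($u_0$ is of class $s=\frac d2$); (b) $\phi(x)=x$ and $\psi(x)=N\rho(x)-(2+2\alpha)$, with $\langle u_0,\rho(x)\rangle\neq N^{-1}(2+2\alpha)$ and $\alpha\neq-\frac n2-1$, for $n\ge 1$ (the class of $u_0$ is $s=\frac d2-1$); (c) $\phi(x)=1$ and $\psi(x)=N\,\theta_0\rho(x)$, with $N\rho(0)=1+2\alpha$ (the class of $u_0$ is $s=\frac d2-2$ as long as $d\ge 4$); where $\rho(x)$ is a monic polynomial such that $\deg\rho(x)=\frac d2$ and $N\neq 0$ is a normalization constant. Moreover, $\{B_n\}_{n\ge0}$ fulfills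 $$x^2B_n''(x)+x\left(N\rho(x)-(3+2\alpha)\right)B_n'(x)-\left\{N\rho(x)\left(N\rho(x)-(2+2\alpha)\right)-Nx\rho'(x)-x+(1+2\alpha)\right\}B_n(x)=-\sum_{\nu=n-1}^{n+d}\rho_{n,\nu}^{d}B_\nu(x),$$ where $$\rho_{n,\mu}^{d}=\begin{cases}\dfrac{\langle u_0,B_n^2\rangle}{\langle u_0,B_\mu^2\rangle}\,\alpha_{n+1}^{n+d-\mu} & \text{if } n+1\le\mu\le n+d,\ \text{with } n\ge0,\\[2mm] \zeta_n-\alpha^2 & \text{if } \mu=n,\ \text{with } n\ge 0,\\ \gamma_1 & \text{if } \mu=n-1,\ \text{with } n\ge1.\end{cases}$$ Here $\gamma_1$ is the first coefficient $\gamma_{n+1}$ (with $n=0$) of the recurrence $B_0=1$, $B_1(x)=x-\beta_0$, $B_{n+2}(x)=(x-\beta_{n+1})B_{n+1}(x)-\gamma_{n+1}B_n(x)$, $n\ge0$, and $\zeta_n$, $\alpha_{\nu+1}^{d+\nu-n}$ are the coefficients of the recurrence $$S_{n+1}\left(\tfrac{\tau^2}{4}\right)=\left(\tfrac{\tau^2}{4}-\zeta_n\right)S_n\left(\tfrac{\tau^2}{4}\right)-\sum_{\nu=\max(0,n-d)}^{n-1}\alpha_{\nu+1}^{d+\nu-n}S_\nu\left(\tfrac{\tau^2}{4}\right),\quad n\ge 0,$$ with $\alpha_{n+1}^{0}\neq 0$ for all $n\ge0$.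
   Context: $\mathbb{N}_0=\{0,1,2,\dots\}$. $\mathcal{P}$ is the vector space of polynomials with complex coefficients and $\mathcal{P}'$ its dual; elements of $\mathcal{P}'$ are called forms and $\langle u,f\rangle$ is the action of $u\in\mathcal{P}'$ on $f\in\mathcal{P}$. For $u\in\mathcal{P}'$ and $g\in\mathcal{P}$: $\langle gu,f\rangle:=\langle u,gf\rangle$ and $\langle Du,f\rangle=\langle u',f\rangle:=-\langle u,f'\rangle$. For a constant $c$, $\theta_c(f)(x)=\frac{f(x)-f(c)}{x-c}$. Superscripts on $\alpha_{n+1}$ and $\rho_{n,\mu}$ are indices, not powers; $B_{-1}:=0$. For $\alpha\ge 0$ and $\tau>0$, $$KL_\alpha[f](\tau)=2\left|\Gamma\left(\alpha+1+\tfrac{i\tau}{2}\right)\right|^{-2}\int_0^\infty x^\alpha K_{i\tau}(2\sqrt{x})f(x)\,dx,$$ where $K_\nu$ is the modified Bessel (Macdonald) function. For polynomial $f$ the result is a polynomial in $\tau^2/4$ of the same degree as $f$, with $KL_\alpha[x^n](\tau)=\left(\alpha+1-\frac{i\tau}{2}\right)_n\left(\alpha+1+\frac{i\tau}{2}\right)_n$, where $(x)_n=\prod_{\sigma=0}^{n-1}(x+\sigma)$, $(x)_0=1$. A sequence of monic polynomials $\{P_n\}_{n\ge0}$ with $\deg P_n=n$ is orthogonal with respect to $u\in\mathcal{P}'$ if $\langle u,P_nP_m\rangle=k_n\delta_{n,m}$ with $k_n\ne0$ for all $n,m$; then $u$ is called regular. The form $u_0$ is the first element of the dual sequence of $\{B_n\}$,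 so $\langle u_0,1\rangle=1$. For a positive integer $d$, $\{P_n\}_{n\ge0}$ is $d$-orthogonal if there are forms $w_0,\dots,w_{d-1}$ such that for each $k=0,\dots,d-1$: $\langle w_k,x^mP_n\rangle=0$ for $n\ge md+k+1$, $m\ge0$, and $\langle w_k,x^mP_{md+k}\rangle\ne0$ for $m\ge0$. A monic $d$-orthogonal sequence satisfies a recurrence of the form displayed above for $S_n$. A form $u$ is semiclassical if it is regular and there are polynomials $\Phi$ (monic) and $\Psi$ with $\deg\Psi\ge1$ such that $D(\Phi u)+\Psi u=0$; "admissible" refers to such pairs $(\Phi,\Psi)$. Its class $s$ is the minimum of $\max(\deg\Phi-2,\deg\Psi-1)$ over all such pairs. The corresponding monic orthogonal polynomial sequence is then also called semiclassical of class $s$.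
   Formalization: Printed formulas are false; proved with: (b) ⟨u₀,ρ⟩=N⁻¹(2+2α) instead of ≠; left side x²Bₙ''−x(2Nρ−(3+2α))Bₙ'+{…}Bₙ; coefficient ζₙ+α² instead of ζₙ−α² at μ=n, and γₙ instead of γ₁ at μ=n−1. *)

theory Defs
  imports "HOL-Analysis.Analysis" "HOL-Computational_Algebra.Polynomial"
begin

text \<open>The Macdonald function \<open>K\<^sub>\<nu>(x)\<close> for \<open>x > 0\<close> and complex \<open>\<nu>\<close>, by its standard integral
  representation (Basset / Schlaefli).\<close>

definition macdonald_K :: "complex \<Rightarrow> real \<Rightarrow> complex" where
  "macdonald_K \<nu> x =
     (LINT t:{0<..}|lborel. of_real (exp (- (x * cosh t))) * cosh (\<nu> * of_real t))"

definition KL :: "real \<Rightarrow> (real \<Rightarrow> complex) \<Rightarrow> real \<Rightarrow> complex" where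
  "KL \<alpha> f \<tau> =
     2 / of_real ((cmod (Gamma (of_real \<alpha> + 1 + \<i> * of_real \<tau> / 2)))\<^sup>2) *
     (LINT x:{0<..}|lborel.
        of_real (x powr \<alpha>) * macdonald_K (\<i> * of_real \<tau>) (2 * sqrt x) * f x)"

type_synonym form = "complex poly \<Rightarrow> complex"

abbreviation X :: "complex poly" where
  "X \<equiv> [:0, 1:]"

definition is_form :: "form \<Rightarrow> bool" where
  "is_form u \<longleftrightarrow> Vector_Spaces.linear smult (*) u"

definition form_mult :: "complex poly \<Rightarrow> form \<Rightarrow> form" where
  "form_mult g u = (\<lambda>f. u (g * f))"

definition form_D :: "form \<Rightarrow> form" where
  "form_D u = (\<lambda>f. - u (pderiv f))"

text \<open>The division is exact.\<close>

definition theta :: "complex \<Rightarrow> complex poly \<Rightarrow> complex poly" where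
  "theta c f = (f - [:poly f c:]) div [:-c, 1:]"

definition monic_sequence :: "(nat \<Rightarrow> complex poly) \<Rightarrow> bool" where
  "monic_sequence P \<longleftrightarrow> (\<forall>n. degree (P n) = n \<and> lead_coeff (P n) = 1)"

definition monic_orthogonal :: "form \<Rightarrow> (nat \<Rightarrow> complex poly) \<Rightarrow> bool" where
  "monic_orthogonal u P \<longleftrightarrow> is_form u \<and> monic_sequence P \<and>
     (\<exists>k. (\<forall>n. k n \<noteq> 0) \<and> (\<forall>n m. u (P n * P m) = (if n = m then k n else 0)))"

definition regular_form :: "form \<Rightarrow> bool" where
  "regular_form u \<longleftrightarrow> (\<exists>P. monic_orthogonal u P)"

definition d_orthogonal :: "nat \<Rightarrow> (nat \<Rightarrow> complex poly) \<Rightarrow> bool" where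
  "d_orthogonal d P \<longleftrightarrow> d \<ge> 1 \<and> monic_sequence P \<and>
     (\<exists>w. \<forall>k<d. is_form (w k) \<and>
        (\<forall>m n. n \<ge> m * d + k + 1 \<longrightarrow> w k (X ^ m * P n) = 0) \<and>
        (\<forall>m. w k (X ^ m * P (m * d + k)) \<noteq> 0))"

definition admissible_pair :: "form \<Rightarrow> complex poly \<Rightarrow> complex poly \<Rightarrow> bool" where
  "admissible_pair u \<Phi> \<Psi> \<longleftrightarrow> lead_coeff \<Phi> = 1 \<and> degree \<Psi> \<ge> 1 \<and>
     (\<forall>f. form_D (form_mult \<Phi> u) f + form_mult \<Psi> u f = 0)"

definition semiclassical :: "form \<Rightarrow> bool" where
  "semiclassical u \<longleftrightarrow> regular_form u \<and> (\<exists>\<Phi> \<Psi>. admissible_pair u \<Phi> \<Psi>)"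

text \<open>Truncated subtraction is harmless here: an admissible \<open>\<Psi>\<close> has degree at least 1, so the
  maximum is never negative.\<close>

definition form_class :: "form \<Rightarrow> nat" where
  "form_class u = (LEAST s. \<exists>\<Phi> \<Psi>. admissible_pair u \<Phi> \<Psi> \<and>
     s = max (degree \<Phi> - 2) (degree \<Psi> - 1))"

definition semiclassical_sequence :: "(nat \<Rightarrow> complex poly) \<Rightarrow> nat \<Rightarrow> bool" where
  "semiclassical_sequence B s \<longleftrightarrow>
     (\<exists>u. monic_orthogonal u B \<and> semiclassical u \<and> form_class u = s)"

text \<open>The value \<open>\<gamma> 0\<close> is not constrained and not used.\<close>

definition three_term_recurrence ::
    "(nat \<Rightarrow> complex poly) \<Rightarrow> (nat \<Rightarrow> complex) \<Rightarrow> (nat \<Rightarrow> complex) \<Rightarrow> bool" where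
  "three_term_recurrence B \<beta> \<gamma> \<longleftrightarrow> B 0 = 1 \<and> B 1 = X - [:\<beta> 0:] \<and>
     (\<forall>n. B (n + 2) = (X - [:\<beta> (n + 1):]) * B (n + 1) - smult (\<gamma> (n + 1)) (B n))"

text \<open>\<open>a i j\<close> stands for the coefficient written with lower index \<open>i\<close> and upper index \<open>j\<close>.
  On \<open>nat\<close>, \<open>n - d\<close> is the maximum of 0 and the integer difference.\<close>

definition d_recurrence ::
    "nat \<Rightarrow> (nat \<Rightarrow> complex poly) \<Rightarrow> (nat \<Rightarrow> complex) \<Rightarrow> (nat \<Rightarrow> nat \<Rightarrow> complex) \<Rightarrow> bool" where
  "d_recurrence d S \<zeta> a \<longleftrightarrow>
     (\<forall>n. S (n + 1) = (X - [:\<zeta> n:]) * S n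
        - (\<Sum>\<nu>\<in>{n - d..<n}. smult (a (\<nu> + 1) (d + \<nu> - n)) (S \<nu>))) \<and>
     (\<forall>n. a (n + 1) 0 \<noteq> 0)"

definition rho_coeff ::
    "real \<Rightarrow> form \<Rightarrow> (nat \<Rightarrow> complex poly) \<Rightarrow> (nat \<Rightarrow> complex) \<Rightarrow> (nat \<Rightarrow> complex) \<Rightarrow>
     (nat \<Rightarrow> nat \<Rightarrow> complex) \<Rightarrow> nat \<Rightarrow> nat \<Rightarrow> nat \<Rightarrow> complex" where
  "rho_coeff \<alpha> u B \<gamma> \<zeta> a d n \<mu> =
     (if n + 1 \<le> \<mu> \<and> \<mu> \<le> n + d
        then u ((B n)\<^sup>2) / u ((B \<mu>)\<^sup>2) * a (n + 1) (n + d - \<mu>)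
      else if \<mu> = n then \<zeta> n + of_real (\<alpha>\<^sup>2)
      else if \<mu> + 1 = n then \<gamma> n
      else 0)"

text \<open>In the sum over \<open>\<nu>\<close> from \<open>n - 1\<close> to \<open>n + d\<close> below, truncated subtraction at \<open>n = 0\<close> drops
  exactly the term with \<open>B\<close> at index -1, which is zero by convention.

  The equation comes from pairing the recurrence of the transforms with \<open>u\<close>: multiplication by
  \<open>\<tau>\<^sup>2/4\<close> corresponds to the operator
  \<open>f \<mapsto> - x\<^sup>2 f'' - (2\<alpha> + 3) x f' + (x - (\<alpha> + 1)\<^sup>2) f\<close>, whose transpose is
  \<open>u \<mapsto> - x\<^sup>2 u'' + (2\<alpha> - 1) x u' + (x - \<alpha>\<^sup>2) u\<close>; it is evaluated at \<open>B\<^sub>n u\<close>.\<close>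

definition structure_equation ::
    "real \<Rightarrow> form \<Rightarrow> (nat \<Rightarrow> complex poly) \<Rightarrow> complex \<Rightarrow> complex poly \<Rightarrow>
     (nat \<Rightarrow> complex) \<Rightarrow> (nat \<Rightarrow> complex) \<Rightarrow> (nat \<Rightarrow> nat \<Rightarrow> complex) \<Rightarrow> nat \<Rightarrow> nat \<Rightarrow> bool" where
  "structure_equation \<alpha> u B N \<rho> \<gamma> \<zeta> a d n \<longleftrightarrow>
     X\<^sup>2 * pderiv (pderiv (B n))
     - X * (smult (2 * N) \<rho> - [:of_real (3 + 2 * \<alpha>):]) * pderiv (B n)
     + (smult N \<rho> * (smult N \<rho> - [:of_real (2 + 2 * \<alpha>):])
          - smult N (X * pderiv \<rho>) - X + [:of_real (1 + 2 * \<alpha>):]) * B n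
     = - (\<Sum>\<nu>\<in>{n - 1..n + d}. smult (rho_coeff \<alpha> u B \<gamma> \<zeta> a d n \<nu>) (B \<nu>))"

end

theory Submission
  imports Defs
begin

text \<open>
  On polynomials, \<open>KL\<^sub>\<alpha>\<close> turns the operator
  \<open>L f = - x\<^sup>2 f'' - (2\<alpha> + 3) x f' + (x - (\<alpha> + 1)\<^sup>2) f\<close> into multiplication by \<open>\<tau>\<^sup>2/4\<close>. Since the
  transform is injective, the recurrence of the \<open>S\<^sub>n\<close> expresses \<open>L B\<^sub>n\<close> through the \<open>B\<^sub>\<nu>\<close> with
  \<open>n - d \<le> \<nu> \<le> n + 1\<close>. By duality the transpose of \<open>L\<close> maps each \<open>B\<^sub>n u\<close> to a polynomial multiple
  of \<open>u\<close>. Commuting it with multiplication by \<open>x\<close> leaves a first-order operator, so comparing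
  \<open>n = 0\<close> and \<open>n = 1\<close> gives \<open>D(x\<^sup>2 u) + G u = 0\<close>. Inserting this into the case \<open>n = 0\<close> forces
  \<open>G = x q\<close> and a Riccati equation for \<open>q\<close> whose degrees give \<open>d = 2 deg q\<close>; here
  \<open>N \<rho> = q + 3 + 2\<alpha>\<close>. The three cases record whether the polynomials \<open>\<Phi>\<close> with \<open>D(\<Phi> u)\<close> a
  polynomial multiple of \<open>u\<close> form the ideal generated by \<open>x\<^sup>2\<close>, \<open>x\<close> or \<open>1\<close>.
\<close>

section \<open>The Mellin transform of the Macdonald function\<close>

text \<open>The change-of-variables theorem speaks of the completed measure, the transform of
  \<open>lborel\<close>; for Borel functions integrability passes between the two.\<close>

lemma absolutely_integrable_on_iff_set_integrable_lborel:
  fixes f :: "'a::euclidean_space \<Rightarrow> 'b::euclidean_space"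
  assumes [measurable]: "f \<in> borel_measurable borel" "S \<in> sets borel"
  shows "f absolutely_integrable_on S \<longleftrightarrow> set_integrable lborel S f"
proof -
  have "(\<lambda>x. indicat_real S x *\<^sub>R f x) \<in> borel_measurable lborel"
    by measurable
  then show ?thesis
    unfolding set_integrable_def by (rule integrable_completion)
qed

lemma exp_image_UNIV: "exp ` (UNIV :: real set) = {0<..}"
  by (auto simp: image_iff) (metis exp_ln)

lemma has_integral_exp_substitution:
  fixes f :: "real \<Rightarrow> complex"
  shows "(\<lambda>v. exp v *\<^sub>R f (exp v)) absolutely_integrable_on UNIV \<and>
      integral UNIV (\<lambda>v. exp v *\<^sub>R f (exp v)) = b \<longleftrightarrow>
    f absolutely_integrable_on {0<..} \<and> integral {0<..} f = b"
proof -
  have "(exp has_field_derivative exp x) (at x within UNIV)" for x :: real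
    by (auto intro!: derivative_eq_intros)
  then have "(\<lambda>v. \<bar>exp v\<bar> *\<^sub>R f (exp v)) absolutely_integrable_on UNIV \<and>
      integral UNIV (\<lambda>v. \<bar>exp v\<bar> *\<^sub>R f (exp v)) = b \<longleftrightarrow>
    f absolutely_integrable_on (exp ` UNIV) \<and> integral (exp ` UNIV) f = b"
    by (intro has_absolute_integral_change_of_variables_real) (auto intro: injI)
  then show ?thesis
    by (simp add: exp_image_UNIV)
qed

lemma lborel_integral_exp_substitution:
  fixes f :: "real \<Rightarrow> complex"
  assumes f [measurable]: "f \<in> borel_measurable borel"
    and int: "integrable lborel (\<lambda>v. exp v *\<^sub>R f (exp v))"
  shows "set_integrable lborel {0<..} f"
    and "(LINT x:{0<..}|lborel. f x) = (LINT v|lborel. exp v *\<^sub>R f (exp v))"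
proof -
  let ?g = "\<lambda>v::real. exp v *\<^sub>R f (exp v)"
  have si: "set_integrable lborel UNIV ?g"
    using int by (simp add: set_integrable_def)
  then have ai: "?g absolutely_integrable_on UNIV"
    by (subst absolutely_integrable_on_iff_set_integrable_lborel) measurable
  have eq: "integral UNIV ?g = integral\<^sup>L lborel ?g"
    using set_borel_integral_eq_integral(2)[OF si] by (simp add: set_lebesgue_integral_def)
  have *: "f absolutely_integrable_on {0<..}" "integral {0<..} f = integral\<^sup>L lborel ?g"
    using has_integral_exp_substitution[of f "integral\<^sup>L lborel ?g"] ai eq by auto
  then show "set_integrable lborel {0<..} f"
    by (subst (asm) absolutely_integrable_on_iff_set_integrable_lborel) auto
  then show "(LINT x:{0<..}|lborel. f x) = integral\<^sup>L lborel ?g"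
    using *(2) set_borel_integral_eq_integral(2) by metis
qed

text \<open>The substitution \<open>x = exp y\<close> turns Euler's integral for \<open>\<Gamma> a\<close> into the integral of this kernel
  over the real line. In these variables the Mellin transform of \<open>K\<^sub>\<nu>\<close> follows from the
  measure-preserving change \<open>y = v/2 + t\<close>, \<open>z = v/2 - t\<close>, a composition of two shears.\<close>

definition gamma_kernel :: "complex \<Rightarrow> real \<Rightarrow> complex" where
  "gamma_kernel a y = exp (a * of_real y - of_real (exp y))"

lemma gamma_kernel_measurable [measurable]: "gamma_kernel a \<in> borel_measurable borel"
  unfolding gamma_kernel_def
  by (intro borel_measurable_continuous_onI continuous_intros)

lemma gamma_kernel_integral:
  assumes a: "Re a > 0"
  shows "integrable lborel (gamma_kernel a)"
    and "integral\<^sup>L lborel (gamma_kernel a) = Gamma a"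
proof -
  let ?f = "\<lambda>t. complex_of_real t powr (a - 1) / of_real (exp t)"
  have eq: "exp v *\<^sub>R ?f (exp v) = gamma_kernel a v" for v :: real
  proof -
    have "complex_of_real (exp v) powr (a - 1) = exp ((a - 1) * of_real v)"
      by (subst powr_def) (auto simp flip: exp_of_real)
    then show ?thesis
      by (simp add: gamma_kernel_def scaleR_conv_of_real exp_diff algebra_simps)
         (simp add: exp_of_real)
  qed
  have "?f absolutely_integrable_on {0<..} \<and> integral {0<..} ?f = Gamma a"
    using absolutely_integrable_Gamma_integral'[OF a] Gamma_integral_complex'[OF a]
    by (auto simp: integral_unique)
  then have "gamma_kernel a absolutely_integrable_on UNIV \<and>
      integral UNIV (gamma_kernel a) = Gamma a"
    using has_integral_exp_substitution[of ?f "Gamma a"] unfolding eq by metis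
  then have *: "set_integrable lborel UNIV (gamma_kernel a)" "integral UNIV (gamma_kernel a) = Gamma a"
    by (auto simp: absolutely_integrable_on_iff_set_integrable_lborel)
  then show "integrable lborel (gamma_kernel a)"
    by (simp add: set_integrable_def)
  show "integral\<^sup>L lborel (gamma_kernel a) = Gamma a"
    using set_borel_integral_eq_integral(2)[OF *(1)] *(2) by (simp add: set_lebesgue_integral_def)
qed

text \<open>For fixed first coordinate a shear is a translation in the second, so every slice keeps
  its integrability and its norm integral; Fubini's criterion then carries over from
  \<open>f\<close>.\<close>

lemma integrable_shear:
  fixes f :: "real \<times> real \<Rightarrow> complex"
  assumes f: "integrable (lborel \<Otimes>\<^sub>M lborel) f"
  shows "integrable (lborel \<Otimes>\<^sub>M lborel) (\<lambda>(x, y). f (x, k * x + y))"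
proof (rule lborel_pair.Fubini_integrable)
  have [measurable]: "f \<in> borel_measurable (borel \<Otimes>\<^sub>M borel)"
    using borel_measurable_integrable[OF f] by simp
  show "(\<lambda>(x, y). f (x, k * x + y)) \<in> borel_measurable (lborel \<Otimes>\<^sub>M lborel)"
    by simp
  have "(LINT y|lborel. norm (f (x, k * x + y))) = (LINT y|lborel. norm (f (x, y)))" for x
    using lborel_integral_real_affine[of 1 "\<lambda>y. norm (f (x, y))" "k * x"] by simp
  then show "integrable lborel
      (\<lambda>x. LINT y|lborel. norm (case (x, y) of (x, y) \<Rightarrow> f (x, k * x + y)))"
    using lborel_pair.integrable_fst'[OF integrable_norm[OF f]] by simp
  show "AE x in lborel. integrable lborel (\<lambda>y. case (x, y) of (x, y) \<Rightarrow> f (x, k * x + y))"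
    using lborel_pair.AE_integrable_fst'[OF f]
  proof eventually_elim
    case (elim x)
    then show ?case
      using lborel_integrable_real_affine_iff[of 1 "\<lambda>y. f (x, y)" "k * x"] by simp
  qed
qed

text \<open>The product is the double integral of the two kernels; the sum \<open>v = y + z\<close>
  of their variables becomes the outer variable and half the difference the inner one.\<close>

lemma Gamma_mult_eq_integral:
  assumes a: "Re a > 0" and b: "Re b > 0"
  defines "H \<equiv> \<lambda>v t. gamma_kernel a (v / 2 + t) * gamma_kernel b (v / 2 - t)"
  shows "integrable lborel (\<lambda>v. LINT t|lborel. H v t)"
    and "(LINT v|lborel. LINT t|lborel. H v t) = Gamma a * Gamma b"
proof -
  let ?F = "\<lambda>(y, z). gamma_kernel a y * gamma_kernel b z"
  note [simp] = gamma_kernel_integral[OF a] gamma_kernel_integral[OF b]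
  have F: "integrable (lborel \<Otimes>\<^sub>M lborel) ?F"
  proof (rule lborel_pair.Fubini_integrable)
    show "?F \<in> borel_measurable (lborel \<Otimes>\<^sub>M lborel)"
      by simp
  qed (auto simp: norm_mult)
  \<comment> \<open>\<open>E\<close> is the product after the first shear, where
    \<open>z = v - y\<close>; swapping the coordinates and a second shear with factor 1/2 then give
    \<open>y = v/2 + t\<close>.\<close>
  define E where "E = (\<lambda>y v. gamma_kernel a y * gamma_kernel b (v - y))"
  have E: "integrable (lborel \<Otimes>\<^sub>M lborel) (case_prod E)"
    using integrable_shear[OF F, of "-1"] by (simp add: E_def case_prod_beta')
  then have E': "integrable (lborel \<Otimes>\<^sub>M lborel) (\<lambda>(v, y). E y v)"
    using lborel_pair.integrable_product_swap[OF E] by simp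
  have H: "integrable (lborel \<Otimes>\<^sub>M lborel) (case_prod H)"
    using integrable_shear[OF E', of "1/2"]
    by (simp add: E_def H_def case_prod_beta' algebra_simps)
  then show "integrable lborel (\<lambda>v. LINT t|lborel. H v t)"
    by (rule lborel_pair.integrable_fst)
  have 1: "(LINT t|lborel. H v t) = (LINT y|lborel. E y v)" for v
    using lborel_integral_real_affine[of 1 "\<lambda>y. E y v" "v / 2"]
    by (simp add: H_def E_def algebra_simps)
  have 2: "(LINT v|lborel. E y v) = gamma_kernel a y * Gamma b" for y
    using lborel_integral_real_affine[of 1 "gamma_kernel b" "- y"]
    by (simp add: E_def)
  show "(LINT v|lborel. LINT t|lborel. H v t) = Gamma a * Gamma b"
    unfolding 1 using lborel_pair.Fubini_integral[OF E] by (simp add: 2)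
qed

section \<open>Integral representation and moments of the Macdonald function\<close>

text \<open>Because cosh t is at least half of exp |t|, the integrand is dominated by a translate of
  the kernel of \<Gamma>(1), evaluated at |t|.\<close>

lemma integrable_exp_minus_cosh:
  assumes x: "x > 0"
  shows "integrable lborel (\<lambda>t::real. exp (- (x * cosh t)))"
proof (rule Bochner_Integration.integrable_bound)
  define G where "G = (\<lambda>y::real. norm (gamma_kernel 1 y))"
  \<comment> \<open>The translation by \<open>ln (x/2)\<close> produces the factor x/2 in the inner
    exponential. Adding both reflections bounds the value at |t| and leaves only affine
    substitutions.\<close>
  define D where "D = (\<lambda>t. 2 / x * (G (ln (x/2) + 1 * t) + G (ln (x/2) + (-1) * t)))"
  have G: "integrable lborel G"
    unfolding G_def using gamma_kernel_integral[of 1] by simp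
  show "integrable lborel D"
    unfolding D_def
    by (intro integrable_mult_right Bochner_Integration.integrable_add
          lborel_integrable_real_affine G) auto
  have Gnn: "G y \<ge> 0" for y by (simp add: G_def)
  have key: "exp (- (x * cosh t)) \<le> 2 / x * G (ln (x/2) + \<bar>t\<bar>)" for t
  proof -
    have G: "G y = exp (y - exp y)" for y by (simp add: G_def gamma_kernel_def)
    have "cosh t \<ge> exp \<bar>t\<bar> / 2"
      by (cases "t \<ge> 0") (auto simp: cosh_def)
    then have "x * cosh t \<ge> x / 2 * exp \<bar>t\<bar>"
      using x by (simp add: field_simps)
    then have "exp (- (x * cosh t)) \<le> 1 * exp (- (x / 2 * exp \<bar>t\<bar>))"
      by simp
    also have "\<dots> \<le> exp \<bar>t\<bar> * exp (- (x / 2 * exp \<bar>t\<bar>))"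
      by (intro mult_right_mono) auto
    also have "\<dots> = 2 / x * G (ln (x/2) + \<bar>t\<bar>)"
    proof -
      have "exp (ln (x/2) + \<bar>t\<bar>) = x / 2 * exp \<bar>t\<bar>"
        using x by (simp add: exp_add)
      then show ?thesis
        using x by (simp add: G exp_diff exp_minus field_simps)
    qed
    finally show ?thesis .
  qed
  have "norm (exp (- (x * cosh t))) \<le> norm (D t)" for t
  proof -
    have "D t \<ge> 2 / x * G (ln (x/2) + \<bar>t\<bar>)"
      unfolding D_def using x Gnn by (intro mult_left_mono) (auto simp: abs_if)
    then show ?thesis using key[of t] by simp
  qed
  then show "AE t in lborel. norm (exp (- (x * cosh t))) \<le> norm (D t)" by simp
  have "(\<lambda>t::real. exp (- (x * cosh t))) \<in> borel_measurable borel"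
    by (intro borel_measurable_continuous_onI continuous_intros)
  then show "(\<lambda>t::real. exp (- (x * cosh t))) \<in> borel_measurable lborel"
    by simp
qed

text \<open>Splitting at 0 and reflecting the negative half pairs the exponentials of
  \<open>t\<close> and \<open>- t\<close> into twice a cosh.\<close>

lemma macdonald_K_eq_full_line:
  assumes x: "x > 0"
  shows "(LINT t|lborel. exp (\<i> * of_real \<tau> * of_real t - of_real (x * cosh t)))
    = 2 * macdonald_K (\<i> * of_real \<tau>) x"
proof -
  define h where "h = (\<lambda>t::real. exp (\<i> * of_real \<tau> * of_real t - of_real (x * cosh t)))"
  have [measurable]: "(cosh :: real \<Rightarrow> real) \<in> borel_measurable borel"
    by (intro borel_measurable_continuous_onI continuous_intros)
  have [measurable]: "h \<in> borel_measurable borel"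
    unfolding h_def by measurable
  have h: "integrable lborel h"
    by (rule Bochner_Integration.integrable_bound[OF integrable_exp_minus_cosh[OF x]])
       (auto simp: h_def)
  then have h': "integrable lborel (\<lambda>t. h (- t))"
    using lborel_integrable_real_affine[OF h, of "-1" 0] by simp
  have pos: "set_integrable lborel {0<..} h" "set_integrable lborel {0<..} (\<lambda>t. h (- t))"
      "set_integrable lborel {..0} h"
    unfolding set_integrable_def using h h' by (auto intro!: integrable_mult_indicator)
  have "(LINT t|lborel. h t) = (LINT t:{0<..} \<union> {..0}|lborel. h t)"
  proof -
    have "{0<..} \<union> {..(0::real)} = UNIV" by auto
    then show ?thesis by (simp add: set_lebesgue_integral_def)
  qed
  also have "\<dots> = (LINT t:{0<..}|lborel. h t) + (LINT t:{..0}|lborel. h t)"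
    by (rule set_integral_Un) (use pos in auto)
  also have "(LINT t:{..0}|lborel. h t) = (LINT t:{0<..}|lborel. h (- t))"
  proof -
    have "(LINT t:{..0}|lborel. h t) = (LINT t|lborel. indicat_real {..0} (- t) *\<^sub>R h (- t))"
      unfolding set_lebesgue_integral_def
      using lborel_integral_real_affine[of "-1" "\<lambda>t. indicat_real {..0} t *\<^sub>R h t" 0] by simp
    \<comment> \<open>After the reflection the range is t \<ge> 0 instead of t > 0; the two differ
      by the null set {0}.\<close>
    also have "\<dots> = (LINT t:{0<..}|lborel. h (- t))"
      unfolding set_lebesgue_integral_def
      by (intro integral_cong_AE; (use AE_lborel_singleton[of "0::real"] in
            \<open>auto elim!: eventually_mono simp: indicator_def\<close>)?) measurable
    finally show ?thesis .
  qed
  also have "(LINT t:{0<..}|lborel. h t) + (LINT t:{0<..}|lborel. h (- t))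
      = (LINT t:{0<..}|lborel. h t + h (- t))"
    using pos by (simp add: set_integral_add)
  also have "\<dots> = (LINT t:{0<..}|lborel.
      2 * (of_real (exp (- (x * cosh t))) * cosh (\<i> * of_real \<tau> * of_real t)))"
  proof -
    have h_eq: "h t = of_real (exp (- (x * cosh t))) * exp (\<i> * of_real \<tau> * of_real t)" for t
      unfolding h_def exp_of_real[symmetric] exp_add[symmetric] by simp
    have "h t + h (- t) =
        2 * (of_real (exp (- (x * cosh t))) * cosh (\<i> * of_real \<tau> * of_real t))" for t
      by (simp add: h_eq cosh_field_def distrib_left)
    then show ?thesis
      by (simp only:)
  qed
  finally show ?thesis
    by (simp add: h_def macdonald_K_def)
qed

lemma macdonald_K_measurable [measurable]: "macdonald_K \<nu> \<in> borel_measurable borel"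
proof -
  have [measurable]: "(\<lambda>t. cosh (\<nu> * complex_of_real t)) \<in> borel_measurable borel"
    "(\<lambda>t::real. cosh t) \<in> borel_measurable borel"
    by (intro borel_measurable_continuous_onI continuous_intros)+
  show ?thesis
    unfolding macdonald_K_def[abs_def] set_lebesgue_integral_def
    by (rule lborel.borel_measurable_lebesgue_integral) measurable
qed

text \<open>With x = e^v, the inner integral in the formula for the product of Gamma values is the
  full-line representation of K at 2 e^(v/2): the linear exponents add up to s v + i \<tau> t, and
  the two inner exponentials to 2 e^(v/2) cosh t. The final 1/2 comes from passing to the full
  line.\<close>

lemma macdonald_K_moment:
  fixes s \<tau> :: real
  assumes s: "s > 0"
  defines "f \<equiv> \<lambda>x. of_real (x powr (s - 1)) * macdonald_K (\<i> * of_real \<tau>) (2 * sqrt x)"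
  shows "set_integrable lborel {0<..} f"
    and "(LINT x:{0<..}|lborel. f x)
      = Gamma (of_real s + \<i> * of_real \<tau> / 2) * Gamma (of_real s - \<i> * of_real \<tau> / 2) / 2"
proof -
  let ?a = "of_real s + \<i> * of_real \<tau> / 2" and ?b = "of_real s - \<i> * of_real \<tau> / 2"
  let ?H = "\<lambda>v t. gamma_kernel ?a (v / 2 + t) * gamma_kernel ?b (v / 2 - t)"
  have [measurable]: "f \<in> borel_measurable borel"
    unfolding f_def by measurable
  have H: "(LINT t|lborel. ?H v t) = 2 * (exp v *\<^sub>R f (exp v))" for v
  proof -
    have "?H v t = of_real (exp (s * v)) *
        exp (\<i> * of_real \<tau> * of_real t - of_real (2 * exp (v / 2) * cosh t))" for t
    proof -
      have "2 * exp (v / 2) * cosh t = exp (v / 2 + t) + exp (v / 2 - t)"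
        unfolding cosh_def diff_conv_add_uminus exp_add by (simp add: algebra_simps)
      then have *: "complex_of_real (2 * exp (v / 2) * cosh t) =
          of_real (exp (v / 2 + t)) + of_real (exp (v / 2 - t))"
        by (metis of_real_add)
      show ?thesis
        unfolding gamma_kernel_def * exp_add[symmetric] exp_of_real[symmetric]
        by (rule arg_cong[where f = exp]) (simp add: field_simps)
    qed
    then have "(LINT t|lborel. ?H v t) =
        of_real (exp (s * v)) * (2 * macdonald_K (\<i> * of_real \<tau>) (2 * exp (v / 2)))"
      by (simp add: macdonald_K_eq_full_line del: of_real_mult)
    also have "sqrt (exp v) = exp (v / 2)"
      by (rule real_sqrt_unique) (auto simp flip: exp_double)
    then have "of_real (exp (s * v)) * (2 * macdonald_K (\<i> * of_real \<tau>) (2 * exp (v / 2)))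
        = 2 * (exp v *\<^sub>R f (exp v))"
      by (simp add: f_def powr_def scaleR_conv_of_real algebra_simps exp_diff flip: exp_add)
    finally show ?thesis .
  qed
  have ab: "Re ?a > 0" "Re ?b > 0"
    using s by auto
  have i: "integrable lborel (\<lambda>v. exp v *\<^sub>R f (exp v))"
    using integrable_mult_right[OF Gamma_mult_eq_integral(1)[OF ab], of "1/2"]
    unfolding H by simp
  show "set_integrable lborel {0<..} f"
    by (rule lborel_integral_exp_substitution(1)) (use i in auto)
  have "(LINT x:{0<..}|lborel. f x) = (LINT v|lborel. exp v *\<^sub>R f (exp v))"
    by (rule lborel_integral_exp_substitution(2)) (use i in auto)
  then show "(LINT x:{0<..}|lborel. f x) = Gamma ?a * Gamma ?b / 2"
    using Gamma_mult_eq_integral(2)[OF ab] unfolding H integral_mult_right_zero by (simp add: mult.commute)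
qed

section \<open>The transform on polynomials\<close>

lemma Gamma_plus_of_nat:
  fixes z :: complex
  assumes "Re z > 0"
  shows "Gamma (z + of_nat n) = (\<Prod>k<n. z + of_nat k) * Gamma z"
proof (induction n)
  case (Suc n)
  have "Re (z + of_nat n) > 0"
    using assms by simp
  then have "z + of_nat n \<notin> \<int>\<^sub>\<le>\<^sub>0"
    by (auto elim!: nonpos_Ints_cases dest: arg_cong[where f = Re])
  then have "Gamma (z + of_nat n + 1) = (z + of_nat n) * Gamma (z + of_nat n)"
    by (rule Gamma_plus1)
  then show ?case
    by (simp add: Suc add_ac)
qed simp

text \<open>Raising the Mellin parameter by n multiplies the two Gamma values by rising factorials,
  whose factors pair to (\<alpha> + 1 + k)^2 + \<tau>^2/4. What remains is \<Gamma> at conjugate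
  points, that is |\<Gamma>|^2, which the normalization of \<open>KL\<close> cancels.\<close>

lemma KL_monomial:
  assumes \<alpha>: "\<alpha> \<ge> 0"
  shows "set_integrable lborel {0<..} (\<lambda>x. of_real (x powr \<alpha>) *
      macdonald_K (\<i> * of_real \<tau>) (2 * sqrt x) * of_real x ^ n)" (is ?int)
    and "KL \<alpha> (\<lambda>x. of_real x ^ n) \<tau> =
      (\<Prod>k<n. (of_real \<alpha> + 1 + of_nat k)\<^sup>2 + of_real (\<tau>\<^sup>2 / 4))" (is ?eq)
proof -
  let ?K = "macdonald_K (\<i> * of_real \<tau>)"
  let ?z = "of_real \<alpha> + 1 + \<i> * of_real \<tau> / 2" and ?w = "of_real \<alpha> + 1 - \<i> * of_real \<tau> / 2"
  define s where "s = \<alpha> + real n + 1"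
  have s: "s > 0" using \<alpha> by (simp add: s_def)
  have e: "indicat_real {0<..} x *\<^sub>R (of_real (x powr \<alpha>) * ?K (2 * sqrt x) * of_real x ^ n)
     = indicat_real {0<..} x *\<^sub>R (of_real (x powr (s - 1)) * ?K (2 * sqrt x))" for x
    by (auto simp: indicator_def s_def powr_add powr_realpow)
  show ?int
    using macdonald_K_moment(1)[OF s] unfolding set_integrable_def e .
  have "(LINT x:{0<..}|lborel. of_real (x powr \<alpha>) * ?K (2 * sqrt x) * of_real x ^ n)
      = Gamma (?z + of_nat n) * Gamma (?w + of_nat n) / 2"
    using macdonald_K_moment(2)[OF s, of \<tau>] unfolding set_lebesgue_integral_def e
    by (simp add: s_def algebra_simps)
  also have "\<dots> = ((\<Prod>k<n. ?z + of_nat k) * (\<Prod>k<n. ?w + of_nat k)) * (Gamma ?z * Gamma ?w) / 2"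
    using \<alpha> by (simp add: Gamma_plus_of_nat)
  also have "(\<Prod>k<n. ?z + of_nat k) * (\<Prod>k<n. ?w + of_nat k)
      = (\<Prod>k<n. (of_real \<alpha> + 1 + of_nat k)\<^sup>2 + of_real (\<tau>\<^sup>2 / 4))"
    by (subst prod.distrib[symmetric], intro prod.cong)
       (auto simp: algebra_simps power2_eq_square)
  also have "?w = cnj ?z" by simp
  also have "Gamma ?z * Gamma (cnj ?z) = of_real ((cmod (Gamma ?z))\<^sup>2)"
    unfolding complex_norm_square by (simp only: cnj_Gamma)
  finally have I: "(LINT x:{0<..}|lborel. of_real (x powr \<alpha>) * ?K (2 * sqrt x) * of_real x ^ n)
      = (\<Prod>k<n. (of_real \<alpha> + 1 + of_nat k)\<^sup>2 + of_real (\<tau>\<^sup>2 / 4)) * of_real ((cmod (Gamma ?z))\<^sup>2) / 2" .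
  have "?z \<notin> \<int>\<^sub>\<le>\<^sub>0"
    using \<alpha> by (auto elim!: nonpos_Ints_cases simp: complex_eq_iff)
  then have "Gamma ?z \<noteq> 0" by (simp add: Gamma_eq_zero_iff)
  then show ?eq
    unfolding KL_def I by simp
qed

text \<open>The transform as a polynomial in the variable \<tau>^2/4, obtained by linear extension
  from its values on monomials.\<close>

definition KL_poly :: "real \<Rightarrow> complex poly \<Rightarrow> complex poly" where
  "KL_poly \<alpha> p =
    (\<Sum>n\<le>degree p. smult (coeff p n) (\<Prod>k<n. [:(of_real \<alpha> + 1 + of_nat k)\<^sup>2, 1:]))"

lemma KL_poly_eval:
  assumes \<alpha>: "\<alpha> \<ge> 0"
  shows "KL \<alpha> (\<lambda>x. poly p (of_real x)) \<tau> = poly (KL_poly \<alpha> p) (of_real (\<tau>\<^sup>2 / 4))"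
proof -
  let ?W = "\<lambda>x. of_real (x powr \<alpha>) * macdonald_K (\<i> * of_real \<tau>) (2 * sqrt x)"
  let ?c = "2 / complex_of_real ((cmod (Gamma (of_real \<alpha> + 1 + \<i> * of_real \<tau> / 2)))\<^sup>2)"
  have "KL \<alpha> (\<lambda>x. poly p (of_real x)) \<tau> =
      ?c * (LINT x:{0<..}|lborel. (\<Sum>n\<le>degree p. coeff p n * (?W x * of_real x ^ n)))"
    unfolding KL_def by (simp add: poly_altdef sum_distrib_left mult_ac)
  also have "(LINT x:{0<..}|lborel. (\<Sum>n\<le>degree p. coeff p n * (?W x * of_real x ^ n)))
      = (\<Sum>n\<le>degree p. coeff p n * (LINT x:{0<..}|lborel. ?W x * of_real x ^ n))"
  proof -
    have "set_integrable lborel {0<..} (\<lambda>x. coeff p n * (?W x * of_real x ^ n))" for n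
      using KL_monomial(1)[OF \<alpha>] by (intro set_integrable_mult_right) auto
    then have "(LINT x:{0<..}|lborel. (\<Sum>n\<le>degree p. coeff p n * (?W x * of_real x ^ n)))
      = (\<Sum>n\<le>degree p. (LINT x:{0<..}|lborel. coeff p n * (?W x * of_real x ^ n)))"
      unfolding set_lebesgue_integral_def set_integrable_def scaleR_sum_right
      by (intro Bochner_Integration.integral_sum) auto
    then show ?thesis
      by simp
  qed
  also have "?c * \<dots> = (\<Sum>n\<le>degree p. coeff p n * KL \<alpha> (\<lambda>x. of_real x ^ n) \<tau>)"
    unfolding KL_def sum_distrib_left by (intro sum.cong) auto
  also have "\<dots> = poly (KL_poly \<alpha> p) (of_real (\<tau>\<^sup>2 / 4))"
    by (simp add: KL_monomial(2)[OF \<alpha>] KL_poly_def poly_sum poly_prod)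
  finally show ?thesis .
qed

section \<open>The transformed sequence and its recurrence\<close>

text \<open>A free upper bound lets polynomials of different degrees be expanded over one common
  range.\<close>

lemma KL_poly_eq_sum:
  assumes "degree p \<le> N"
  shows "KL_poly \<alpha> p =
    (\<Sum>n\<le>N. smult (coeff p n) (\<Prod>k<n. [:(of_real \<alpha> + 1 + of_nat k)\<^sup>2, 1:]))"
  unfolding KL_poly_def
  by (rule sum.mono_neutral_left) (use assms in \<open>auto simp: coeff_eq_0\<close>)

lemma KL_poly_add: "KL_poly \<alpha> (p + q) = KL_poly \<alpha> p + KL_poly \<alpha> q"
proof -
  let ?N = "max (degree p) (degree q)"
  show ?thesis
    by (subst (1 2 3) KL_poly_eq_sum[where N = ?N])
       (auto simp: sum.distrib smult_add_left intro: degree_add_le)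
qed

lemma smult_sum_right: "smult c (\<Sum>i\<in>A. f i) = (\<Sum>i\<in>A. smult c (f i))"
  by (induction A rule: infinite_finite_induct) (auto simp: smult_add_right)

lemma KL_poly_smult: "KL_poly \<alpha> (smult c p) = smult c (KL_poly \<alpha> p)"
proof -
  have "KL_poly \<alpha> (smult c p) = (\<Sum>n\<le>degree p. smult (coeff (smult c p) n)
      (\<Prod>k<n. [:(of_real \<alpha> + 1 + of_nat k)\<^sup>2, 1:]))"
    by (rule KL_poly_eq_sum) (rule degree_smult_le)
  also have "\<dots> = smult c (KL_poly \<alpha> p)"
    unfolding KL_poly_def by (simp add: smult_sum_right)
  finally show ?thesis .
qed

lemma KL_poly_sum: "KL_poly \<alpha> (\<Sum>i\<in>A. f i) = (\<Sum>i\<in>A. KL_poly \<alpha> (f i))"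
proof -
  have "KL_poly \<alpha> 0 = 0" by (simp add: KL_poly_def)
  then show ?thesis
    by (induction A rule: infinite_finite_induct) (auto simp: KL_poly_add)
qed

lemma KL_poly_monom:
  "KL_poly \<alpha> (monom 1 n) = (\<Prod>k<n. [:(of_real \<alpha> + 1 + of_nat k)\<^sup>2, 1:])"
proof -
  have "KL_poly \<alpha> (monom 1 n) = (\<Sum>m\<le>n. if m = n
      then \<Prod>k<n. [:(of_real \<alpha> + 1 + of_nat k)\<^sup>2, 1:] else 0)"
    unfolding KL_poly_def degree_monom_eq[OF one_neq_zero] by (intro sum.cong) auto
  then show ?thesis by simp
qed

text \<open>The image of the n-th monomial is monic of degree n, so the leading coefficient
  survives; this is the injectivity of the transform.\<close>

lemma KL_poly_eq_0_iff [simp]: "KL_poly \<alpha> p = 0 \<longleftrightarrow> p = 0"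
proof
  let ?W = "\<lambda>n. \<Prod>k<n. [:(complex_of_real \<alpha> + 1 + of_nat k)\<^sup>2, 1:]"
  have deg: "degree (?W n) = n" for n
    by (subst degree_prod_eq_sum_degree) auto
  have lc: "coeff (?W n) n = 1" for n
    using lead_coeff_prod[of "\<lambda>k. [:(complex_of_real \<alpha> + 1 + of_nat k)\<^sup>2, 1:]" "{..<n}"]
    unfolding deg by simp
  have "coeff (KL_poly \<alpha> p) (degree p) =
      (\<Sum>n\<le>degree p. if n = degree p then coeff p n else 0)"
    unfolding KL_poly_def coeff_sum coeff_smult
    by (rule sum.cong) (auto simp: lc deg coeff_eq_0)
  then have "coeff (KL_poly \<alpha> p) (degree p) = lead_coeff p" by simp
  moreover assume "KL_poly \<alpha> p = 0"
  ultimately show "p = 0" by simp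
qed (simp add: KL_poly_def)

section \<open>The operator corresponding to multiplication by \<tau>^2/4\<close>

text \<open>With the Euler operator E = x d/dx this is x - (E + \<alpha> + 1)^2, which explains its
  simple action on monomials.\<close>

definition KL_operator :: "real \<Rightarrow> complex poly \<Rightarrow> complex poly" where
  "KL_operator \<alpha> f = - (X\<^sup>2 * pderiv (pderiv f)) - [:of_real (2 * \<alpha> + 3):] * (X * pderiv f)
     + (X - [:of_real ((\<alpha> + 1)\<^sup>2):]) * f"

lemma KL_operator_add: "KL_operator \<alpha> (p + q) = KL_operator \<alpha> p + KL_operator \<alpha> q"
  by (simp add: KL_operator_def pderiv_add algebra_simps del: mult_pCons_left mult_pCons_right)

lemma KL_operator_smult: "KL_operator \<alpha> (smult c p) = smult c (KL_operator \<alpha> p)"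
  by (simp add: KL_operator_def pderiv_smult smult_add_right smult_diff_right
      del: mult_pCons_left mult_pCons_right)

lemma KL_operator_sum: "KL_operator \<alpha> (\<Sum>i\<in>A. f i) = (\<Sum>i\<in>A. KL_operator \<alpha> (f i))"
proof -
  have "KL_operator \<alpha> 0 = 0" by (simp add: KL_operator_def)
  then show ?thesis
    by (induction A rule: infinite_finite_induct) (auto simp: KL_operator_add)
qed

lemma KL_operator_monom:
  "KL_operator \<alpha> (monom 1 n) =
    monom 1 (Suc n) - smult ((of_real \<alpha> + 1 + of_nat n)\<^sup>2) (monom 1 n)"
proof -
  have "poly (KL_operator \<alpha> (monom 1 n)) x =
    poly (monom 1 (Suc n) - smult ((of_real \<alpha> + 1 + of_nat n)\<^sup>2) (monom 1 n)) x" for x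
  proof -
    have 1: "x * poly (pderiv (monom 1 n)) x = of_nat n * x ^ n"
      by (cases n) (auto simp: pderiv_monom poly_monom)
    have 2: "x\<^sup>2 * poly (pderiv (pderiv (monom 1 n))) x = of_nat n * (of_nat n - 1) * x ^ n"
      by (cases n; cases "n - 1") (auto simp: pderiv_monom poly_monom algebra_simps power2_eq_square)
    show ?thesis
      unfolding KL_operator_def
      by (simp add: 1 2 poly_monom del: mult_pCons_left mult_pCons_right)
        (simp add: algebra_simps power2_eq_square)
  qed
  then show ?thesis
    by (intro poly_eq_poly_eq_iff[THEN iffD1] ext)
qed

text \<open>On the n-th monomial the next factor of the product is \<open>X\<close> plus (\<alpha> +
  1 + n)^2; the operator subtracts exactly this constant, so only the factor \<open>X\<close> is
  left.\<close>

lemma KL_poly_KL_operator: "KL_poly \<alpha> (KL_operator \<alpha> p) = X * KL_poly \<alpha> p"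
proof -
  have mono: "KL_poly \<alpha> (KL_operator \<alpha> (monom c n)) = X * KL_poly \<alpha> (monom c n)" for c n
  proof -
    have minus: "KL_poly \<alpha> (p - q) = KL_poly \<alpha> p - KL_poly \<alpha> q" for p q
      using KL_poly_add[of \<alpha> "p - q" q] by simp
    have "monom c n = smult c (monom 1 n)"
      by (simp add: smult_monom)
    moreover have "KL_poly \<alpha> (KL_operator \<alpha> (monom 1 n)) = X * KL_poly \<alpha> (monom 1 n)"
      unfolding KL_operator_monom minus KL_poly_smult KL_poly_monom by simp
    ultimately show ?thesis
      by (simp only: KL_operator_smult KL_poly_smult mult_smult_right)
  qed
  have "KL_poly \<alpha> (KL_operator \<alpha> (\<Sum>i\<in>A. monom (coeff p i) i)) =
      X * KL_poly \<alpha> (\<Sum>i\<in>A. monom (coeff p i) i)" if "finite A" for A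
    using that
  proof (induction A rule: finite_induct)
    case empty
    show ?case by (simp add: KL_operator_def KL_poly_def)
  next
    case (insert i A)
    then show ?case
      by (simp only: sum.insert[OF insert.hyps] KL_operator_add KL_poly_add mono distrib_left)
  qed
  from this[of "{..degree p}"] show ?thesis
    by (simp only: finite_atMost poly_as_sum_of_monoms)
qed

text \<open>The values \<tau>^2/4 fill the positive half line, too many points for the roots of a
  nonzero difference.\<close>

lemma poly_eqI_positive_reals:
  fixes p q :: "complex poly"
  assumes "\<And>\<tau>::real. \<tau> > 0 \<Longrightarrow> poly p (of_real (\<tau>\<^sup>2 / 4)) = poly q (of_real (\<tau>\<^sup>2 / 4))"
  shows "p = q"
proof (rule ccontr)
  assume "p \<noteq> q"
  then have "finite {z. poly (p - q) z = 0}"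
    by (intro poly_roots_finite) simp
  moreover have "complex_of_real ` {0<..} \<subseteq> {z. poly (p - q) z = 0}"
  proof clarsimp
    fix y :: real assume "y > 0"
    then show "poly p (of_real y) = poly q (of_real y)"
      using assms[of "2 * sqrt y"] by (simp add: power_mult_distrib)
  qed
  ultimately have "finite (complex_of_real ` {0<..})"
    by (rule finite_subset[rotated])
  then have "finite {0::real<..}"
    by (rule finite_imageD) (simp add: inj_on_def)
  then show False
    using infinite_Ioi by blast
qed

lemma KL_transformed_sequence:
  assumes "\<alpha> \<ge> 0"
    and "\<And>n \<tau>. \<tau> > 0 \<Longrightarrow>
           poly (S n) (of_real (\<tau>\<^sup>2 / 4)) = KL \<alpha> (\<lambda>x. poly (B n) (of_real x)) \<tau>"
  shows "S n = KL_poly \<alpha> (B n)"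
  by (rule poly_eqI_positive_reals) (use assms KL_poly_eval in metis)

section \<open>Monic sequences, forms and their recurrences\<close>

lemma monic_sequence_0:
  assumes "monic_sequence B"
  shows "B 0 = 1"
  using assms unfolding monic_sequence_def
  by (metis degree_eq_zeroE lead_coeff_pCons(2) one_pCons)

lemma monic_sequence_span:
  assumes B: "monic_sequence B" and "degree f \<le> n"
  shows "\<exists>c. f = (\<Sum>\<nu>\<le>n. smult (c \<nu>) (B \<nu>))"
  using assms(2)
proof (induction n arbitrary: f)
  case 0
  have "B 0 = 1"
    by (rule monic_sequence_0[OF B])
  moreover obtain c where "f = [:c:]"
    using 0 by (auto elim: degree_eq_zeroE)
  ultimately have "f = (\<Sum>\<nu>\<le>0. smult c (B \<nu>))" by simp
  then show ?case by (rule exI[of _ "\<lambda>_. c"])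
next
  case (Suc n)
  let ?g = "f - smult (coeff f (Suc n)) (B (Suc n))"
  have deg: "degree (B (Suc n)) = Suc n" "coeff (B (Suc n)) (Suc n) = 1"
    using B unfolding monic_sequence_def by metis+
  have "degree ?g \<le> n"
  proof (rule degree_le, intro allI impI)
    fix i assume "n < i"
    then consider "i = Suc n" | "i > Suc n" by linarith
    then show "coeff ?g i = 0"
      using deg Suc.prems by cases (auto simp: coeff_eq_0)
  qed
  then obtain c where c: "?g = (\<Sum>\<nu>\<le>n. smult (c \<nu>) (B \<nu>))"
    using Suc.IH by blast
  have "f = (\<Sum>\<nu>\<le>Suc n. smult ((c(Suc n := coeff f (Suc n))) \<nu>) (B \<nu>))"
  proof -
    have "(\<Sum>\<nu>\<le>n. smult ((c(Suc n := coeff f (Suc n))) \<nu>) (B \<nu>)) = ?g"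
      unfolding c by (intro sum.cong) auto
    then show ?thesis by simp
  qed
  then show ?case by blast
qed

lemma monic_sequence_mult_X:
  assumes "monic_sequence B"
  shows "\<exists>c. X * B n = B (Suc n) + (\<Sum>\<nu>\<le>n. smult (c \<nu>) (B \<nu>))"
proof -
  have deg: "degree (B m) = m" "coeff (B m) m = 1" for m
    using assms unfolding monic_sequence_def by metis+
  have "degree (X * B n - B (Suc n)) \<le> n"
  proof (rule degree_le, intro allI impI)
    fix i assume "n < i"
    then obtain j where j: "i = Suc j" "n \<le> j" by (cases i) auto
    then consider "j = n" | "j > n" by linarith
    then show "coeff (X * B n - B (Suc n)) i = 0"
      using deg j by cases (auto simp: coeff_eq_0)
  qed
  then obtain c where "X * B n - B (Suc n) = (\<Sum>\<nu>\<le>n. smult (c \<nu>) (B \<nu>))"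
    using monic_sequence_span[OF assms] by blast
  then have "X * B n = B (Suc n) + (\<Sum>\<nu>\<le>n. smult (c \<nu>) (B \<nu>))"
    by (simp add: algebra_simps)
  then show ?thesis by blast
qed

lemma is_form_simps:
  assumes "is_form u"
  shows "u (f + g) = u f + u g" "u (f - g) = u f - u g" "u (- f) = - u f"
    "u (smult c f) = c * u f" "u 0 = 0" "u (sum h A) = (\<Sum>i\<in>A. u (h i))"
proof -
  interpret Vector_Spaces.linear smult "(*)" u
    using assms unfolding is_form_def .
  show "u (f + g) = u f + u g" "u (f - g) = u f - u g" "u (- f) = - u f"
    "u (smult c f) = c * u f" "u 0 = 0" "u (sum h A) = (\<Sum>i\<in>A. u (h i))"
    by (simp_all add: add diff neg scale sum)
qed

text \<open>Expand \<open>X * S n\<close> in the sequence. The forms times powers of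
  \<open>X\<close> are triangular against the sequence, so they read off the coefficients from the
  lowest index upwards: those below n - d vanish, and the one at n - d does not.\<close>

lemma d_orthogonal_recurrence:
  assumes S: "d_orthogonal d S"
  shows "\<exists>\<zeta> a. d_recurrence d S \<zeta> a"
proof -
  have d: "d \<ge> 1" and mono: "monic_sequence S"
    using S by (auto simp: d_orthogonal_def)
  obtain w where w: "\<And>k. k < d \<Longrightarrow> is_form (w k)"
      "\<And>k m n. k < d \<Longrightarrow> n \<ge> m * d + k + 1 \<Longrightarrow> w k (X ^ m * S n) = 0"
      "\<And>k m. k < d \<Longrightarrow> w k (X ^ m * S (m * d + k)) \<noteq> 0"
    using S unfolding d_orthogonal_def by blast
  obtain c where c: "\<And>n. X * S n = S (Suc n) + (\<Sum>\<nu>\<le>n. smult (c n \<nu>) (S \<nu>))"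
    using monic_sequence_mult_X[OF mono] by metis
  \<comment> \<open>Write \<open>\<nu>\<close> as m d + k with k < d. The form \<open>w k\<close>
    times the m-th power of \<open>X\<close> kills every \<open>S \<mu>\<close> with \<mu> > \<nu>,
    and the coefficients with \<mu> < \<nu> are zero by assumption.\<close>
  have step: "w (\<nu> mod d) (X ^ (\<nu> div d + 1) * S n)
      = c n \<nu> * w (\<nu> mod d) (X ^ (\<nu> div d) * S \<nu>)"
    if \<nu>: "\<nu> \<le> n" and less: "\<And>\<mu>. \<mu> < \<nu> \<Longrightarrow> c n \<mu> = 0" for n \<nu>
  proof -
    let ?w = "w (\<nu> mod d)" and ?m = "\<nu> div d"
    have k: "\<nu> mod d < d" using d by simp
    note lin = is_form_simps[OF w(1)[OF k]]
    have 0: "?w (X ^ ?m * S \<mu>) = 0" if "\<mu> > \<nu>" for \<mu>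
      using that w(2)[OF k, of ?m \<mu>] by simp
    have "X ^ (?m + 1) * S n = X ^ ?m * (X * S n)"
      by (simp add: mult_ac)
    also have "\<dots> = X ^ ?m * S (Suc n) + (\<Sum>\<mu>\<le>n. smult (c n \<mu>) (X ^ ?m * S \<mu>))"
      unfolding c by (simp add: distrib_left sum_distrib_left)
    finally have "?w (X ^ (?m + 1) * S n) =
        ?w (X ^ ?m * S (Suc n)) + (\<Sum>\<mu>\<le>n. c n \<mu> * ?w (X ^ ?m * S \<mu>))"
      by (simp only: lin)
    also have "?w (X ^ ?m * S (Suc n)) = 0"
      using 0[of "Suc n"] \<nu> by simp
    also have "(\<Sum>\<mu>\<le>n. c n \<mu> * ?w (X ^ ?m * S \<mu>)) =
        (\<Sum>\<mu>\<le>n. if \<mu> = \<nu> then c n \<nu> * ?w (X ^ ?m * S \<nu>) else 0)"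
    proof (intro sum.cong refl)
      fix \<mu>
      show "c n \<mu> * ?w (X ^ ?m * S \<mu>) = (if \<mu> = \<nu> then c n \<nu> * ?w (X ^ ?m * S \<nu>) else 0)"
        using less[of \<mu>] 0[of \<mu>] by (cases \<mu> \<nu> rule: linorder_cases) auto
    qed
    finally show ?thesis using \<nu> by simp
  qed
  have zero: "c n \<nu> = 0" if "\<nu> + d < n" for n \<nu>
    using that
  proof (induction \<nu> rule: less_induct)
    case (less \<nu>)
    have k: "\<nu> mod d < d" using d by simp
    have "(\<nu> div d + 1) * d + \<nu> mod d = \<nu> + d" by simp
    then have "w (\<nu> mod d) (X ^ (\<nu> div d + 1) * S n) = 0"
      using less.prems by (intro w(2)[OF k]) simp
    moreover have "w (\<nu> mod d) (X ^ (\<nu> div d) * S \<nu>) \<noteq> 0"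
      using w(3)[OF k, of "\<nu> div d"] by simp
    ultimately show ?case
      using step[of \<nu> n] less by simp
  qed
  have nonzero: "c (n + d) n \<noteq> 0" for n
  proof -
    have k: "n mod d < d" using d by simp
    have "(n div d + 1) * d + n mod d = n + d" by simp
    then have "w (n mod d) (X ^ (n div d + 1) * S (n + d)) \<noteq> 0"
      using w(3)[OF k, of "n div d + 1"] by simp
    then show ?thesis
      using step[of n "n + d"] zero by auto
  qed
  \<comment> \<open>Solves the index convention i = \<nu> + 1, j = d + \<nu> - n for \<nu> = i - 1
    and n = d + (i - 1) - j.\<close>
  define a where "a = (\<lambda>i j. c (d + (i - 1) - j) (i - 1))"
  have "S (n + 1) = (X - [:c n n:]) * S n
        - (\<Sum>\<nu>\<in>{n - d..<n}. smult (a (\<nu> + 1) (d + \<nu> - n)) (S \<nu>))" for n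
  proof -
    have "(\<Sum>\<nu>\<le>n. smult (c n \<nu>) (S \<nu>)) =
        smult (c n n) (S n) + (\<Sum>\<nu><n. smult (c n \<nu>) (S \<nu>))"
      by (simp add: lessThan_Suc_atMost[symmetric])
    also have "(\<Sum>\<nu><n. smult (c n \<nu>) (S \<nu>)) = (\<Sum>\<nu>\<in>{n - d..<n}. smult (c n \<nu>) (S \<nu>))"
      by (rule sum.mono_neutral_right) (auto simp: zero)
    also have "\<dots> = (\<Sum>\<nu>\<in>{n - d..<n}. smult (a (\<nu> + 1) (d + \<nu> - n)) (S \<nu>))"
      by (intro sum.cong) (auto simp: a_def)
    finally show ?thesis
      using c[of n] by (simp add: algebra_simps)
  qed
  moreover have "a (n + 1) 0 \<noteq> 0" for n
    using nonzero[of n] by (simp add: a_def add.commute)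
  ultimately show ?thesis
    unfolding d_recurrence_def by (intro exI[of _ "\<lambda>n. c n n"] exI[of _ a]) auto
qed

lemma monic_orthogonal_simps:
  assumes "monic_orthogonal u B"
  shows "is_form u" "monic_sequence B" "m \<noteq> n \<Longrightarrow> u (B m * B n) = 0" "u (B n * B n) \<noteq> 0"
  using assms unfolding monic_orthogonal_def by auto

text \<open>Pairing with \<open>B m\<close> isolates the m-th coefficient of \<open>g\<close>. This
  allows \<open>u\<close> to be cancelled from equations between its polynomial multiples.\<close>

lemma monic_orthogonal_nondegenerate:
  assumes B: "monic_orthogonal u B" and 0: "\<And>n. u (g * B n) = 0"
  shows "g = 0"
proof -
  note o = monic_orthogonal_simps[OF B]
  obtain c where c: "g = (\<Sum>\<nu>\<le>degree g. smult (c \<nu>) (B \<nu>))"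
    using monic_sequence_span[OF o(2)] by blast
  have "c m = 0" if "m \<le> degree g" for m
  proof -
    have "u (g * B m) = (\<Sum>\<nu>\<le>degree g. c \<nu> * u (B \<nu> * B m))"
      by (subst c) (simp add: sum_distrib_right is_form_simps[OF o(1)])
    also have "\<dots> = (\<Sum>\<nu>\<le>degree g. if \<nu> = m then c m * u (B m * B m) else 0)"
      by (intro sum.cong) (auto simp: o(3))
    finally show "c m = 0"
      using 0[of m] that o(4) by simp
  qed
  then have "(\<Sum>\<nu>\<le>degree g. smult (c \<nu>) (B \<nu>)) = 0"
    by (intro sum.neutral) auto
  then show ?thesis using c by simp
qed

text \<open>Multiplication by \<open>X\<close> is symmetric for the pairing, so the expansion of
  \<open>X * B n\<close> stops at index n - 1. The same symmetry gives the ratio of norms, which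
  later produces the lowest entry of \<open>rho_coeff\<close>.\<close>

lemma monic_orthogonal_three_term:
  assumes B: "monic_orthogonal u B"
  shows "\<exists>\<beta> \<gamma>. three_term_recurrence B \<beta> \<gamma> \<and>
    (\<forall>n. u (B (Suc n) * B (Suc n)) = \<gamma> (Suc n) * u (B n * B n))"
proof -
  note o = monic_orthogonal_simps[OF B] and lin = is_form_simps[OF monic_orthogonal_simps(1)[OF B]]
  obtain c where c: "\<And>n. X * B n = B (Suc n) + (\<Sum>\<nu>\<le>n. smult (c n \<nu>) (B \<nu>))"
    using monic_sequence_mult_X[OF o(2)] by metis
  have pair: "u (X * B n * B m) = u (B (Suc n) * B m) + (if m \<le> n then c n m * u (B m * B m) else 0)"
    for m n
  proof -
    have "u (X * B n * B m) = u (B (Suc n) * B m) + (\<Sum>\<nu>\<le>n. c n \<nu> * u (B \<nu> * B m))"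
      unfolding c distrib_right sum_distrib_right lin mult_smult_left ..
    also have "(\<Sum>\<nu>\<le>n. c n \<nu> * u (B \<nu> * B m)) =
        (\<Sum>\<nu>\<le>n. if \<nu> = m then c n m * u (B m * B m) else 0)"
      by (intro sum.cong) (auto simp: o(3))
    finally show ?thesis by auto
  qed
  have sym: "u (X * B n * B m) = u (X * B m * B n)" for m n
    by (simp add: mult_ac)
  have zero: "c n m = 0" if "Suc m < n" for m n
    using pair[of n m] pair[of m n] sym[of n m] that o(4)[of m] by (simp add: o(3))
  have \<gamma>: "u (B (Suc n) * B (Suc n)) = c (Suc n) n * u (B n * B n)" for n
    using pair[of "Suc n" n] pair[of n "Suc n"] sym[of "Suc n" n] by (simp add: o(3))
  have "B (n + 2) = (X - [:c (n + 1) (n + 1):]) * B (n + 1) - smult (c (n + 1) n) (B n)" for n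
  proof -
    have "(\<Sum>\<nu>\<le>Suc n. smult (c (Suc n) \<nu>) (B \<nu>)) =
        smult (c (Suc n) (Suc n)) (B (Suc n)) + (\<Sum>\<nu>\<le>n. smult (c (Suc n) \<nu>) (B \<nu>))"
      by simp
    also have "(\<Sum>\<nu>\<le>n. smult (c (Suc n) \<nu>) (B \<nu>)) = (\<Sum>\<nu>\<in>{n}. smult (c (Suc n) \<nu>) (B \<nu>))"
      by (rule sum.mono_neutral_right) (auto simp: zero)
    finally show ?thesis
      using c[of "Suc n"] by (simp add: algebra_simps)
  qed
  moreover have "B 1 = X - [:c 0 0:]"
    using c[of 0] monic_sequence_0[OF o(2)] by (simp add: algebra_simps)
  ultimately have "three_term_recurrence B (\<lambda>n. c n n) (\<lambda>n. c n (n - 1))"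
    using monic_sequence_0[OF o(2)] unfolding three_term_recurrence_def by simp
  then show ?thesis using \<gamma> by force
qed

section \<open>Transfer of the recurrence and duality\<close>

text \<open>Both sides have the same image under \<open>KL_poly\<close>, by the intertwining
  relation and the recurrence; injectivity does the rest.\<close>

lemma KL_operator_expansion:
  assumes "d_recurrence d (\<lambda>n. KL_poly \<alpha> (B n)) \<zeta> a"
  shows "KL_operator \<alpha> (B n) = B (n + 1) + smult (\<zeta> n) (B n)
    + (\<Sum>\<nu>\<in>{n - d..<n}. smult (a (\<nu> + 1) (d + \<nu> - n)) (B \<nu>))"
proof -
  let ?R = "B (n + 1) + smult (\<zeta> n) (B n)
    + (\<Sum>\<nu>\<in>{n - d..<n}. smult (a (\<nu> + 1) (d + \<nu> - n)) (B \<nu>))"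
  have "KL_poly \<alpha> (B (n + 1)) = (X - [:\<zeta> n:]) * KL_poly \<alpha> (B n)
        - (\<Sum>\<nu>\<in>{n - d..<n}. smult (a (\<nu> + 1) (d + \<nu> - n)) (KL_poly \<alpha> (B \<nu>)))"
    using assms unfolding d_recurrence_def by blast
  then have "KL_poly \<alpha> ?R = X * KL_poly \<alpha> (B n)"
    by (simp add: KL_poly_add KL_poly_sum KL_poly_smult algebra_simps)
  then have "KL_poly \<alpha> (KL_operator \<alpha> (B n) + smult (- 1) ?R) = 0"
    unfolding KL_poly_add KL_poly_smult KL_poly_KL_operator by simp
  then have "KL_operator \<alpha> (B n) + smult (- 1) ?R = 0"
    by (simp only: KL_poly_eq_0_iff)
  then show ?thesis by (simp add: algebra_simps add_eq_0_iff2)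
qed

text \<open>The sum is the polynomial \<open>P\<close> for which \<open>P u\<close> is the transpose of the operator applied
  to \<open>B\<^sub>n u\<close>.\<close>

lemma form_KL_operator:
  assumes B: "monic_orthogonal u B"
    and rec: "d_recurrence d (\<lambda>n. KL_poly \<alpha> (B n)) \<zeta> a"
    and \<gamma>: "\<And>n. u (B (Suc n) * B (Suc n)) = \<gamma> (Suc n) * u (B n * B n)"
  shows "u (B n * KL_operator \<alpha> f) =
    u (((\<Sum>\<nu>\<in>{n - 1..n + d}. smult (rho_coeff \<alpha> u B \<gamma> \<zeta> a d n \<nu>) (B \<nu>))
        - smult (of_real (\<alpha>\<^sup>2)) (B n)) * f)"
proof -
  note o = monic_orthogonal_simps[OF B] and lin = is_form_simps[OF monic_orthogonal_simps(1)[OF B]]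
  let ?r = "rho_coeff \<alpha> u B \<gamma> \<zeta> a d n"
  let ?P = "(\<Sum>\<nu>\<in>{n - 1..n + d}. smult (?r \<nu>) (B \<nu>)) - smult (of_real (\<alpha>\<^sup>2)) (B n)"
  \<comment> \<open>Both sides are linear in \<open>f\<close>, so comparing the matrix entries on
    the basis \<open>B m\<close> suffices.\<close>
  have base: "u (B n * KL_operator \<alpha> (B m)) = u (?P * B m)" for m
  proof -
    have l: "u (B n * KL_operator \<alpha> (B m)) =
        (if n = m + 1 then u (B n * B n) else 0) + (if n = m then \<zeta> n * u (B n * B n) else 0)
        + (if n \<in> {m - d..<m} then a (n + 1) (d + n - m) * u (B n * B n) else 0)"
    proof -
      have "(\<Sum>\<nu>\<in>{m - d..<m}. a (\<nu> + 1) (d + \<nu> - m) * u (B n * B \<nu>)) =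
        (\<Sum>\<nu>\<in>{m - d..<m}. if \<nu> = n then a (n + 1) (d + n - m) * u (B n * B n) else 0)"
        by (intro sum.cong) (auto simp: o(3))
      then show ?thesis
        unfolding KL_operator_expansion[OF rec] distrib_left sum_distrib_left lin mult_smult_right
        by (auto simp: o(3))
    qed
    have "(\<Sum>\<nu>\<in>{n - 1..n + d}. ?r \<nu> * u (B \<nu> * B m)) =
        (\<Sum>\<nu>\<in>{n - 1..n + d}. if \<nu> = m then ?r m * u (B m * B m) else 0)"
      by (intro sum.cong) (auto simp: o(3))
    then have r: "u (?P * B m) = (if m \<in> {n - 1..n + d} then ?r m * u (B m * B m) else 0)
        - (if n = m then of_real (\<alpha>\<^sup>2) * u (B n * B n) else 0)"
      unfolding left_diff_distrib sum_distrib_right lin mult_smult_left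
      by (auto simp: o(3))
    \<comment> \<open>The entries are banded. On the diagonal, \<alpha>^2 in
      \<open>rho_coeff\<close> cancels the subtracted multiple of \<open>B n\<close>; above it, the
      quotient of norms cancels the norm of \<open>B m\<close>.\<close>
    consider "n = Suc m" | "n = m" | "n < m" "m \<le> n + d" | "n < m" "n + d < m" | "Suc m < n"
      by linarith
    then show ?thesis
    proof cases
      case 1
      then show ?thesis unfolding l r using \<gamma>[of m] by (simp add: rho_coeff_def)
    next
      case 2
      then show ?thesis unfolding l r by (simp add: rho_coeff_def algebra_simps)
    next
      case 3
      then show ?thesis unfolding l r using o(4)[of m]
        by (auto simp: rho_coeff_def power2_eq_square add.commute)
    qed (unfold l r, auto)
  qed
  obtain c where c: "f = (\<Sum>\<nu>\<le>degree f. smult (c \<nu>) (B \<nu>))"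
    using monic_sequence_span[OF o(2)] by blast
  have "u (B n * KL_operator \<alpha> f) = (\<Sum>\<nu>\<le>degree f. c \<nu> * u (B n * KL_operator \<alpha> (B \<nu>)))"
    by (subst c) (simp only: KL_operator_sum KL_operator_smult sum_distrib_left lin mult_smult_right)
  also have "\<dots> = (\<Sum>\<nu>\<le>degree f. c \<nu> * u (?P * B \<nu>))"
    unfolding base ..
  also have "\<dots> = u (?P * f)"
    by (subst (2) c) (simp only: sum_distrib_left lin mult_smult_right)
  finally show ?thesis .
qed

section \<open>Pearson equations\<close>

text \<open>\<open>pearson u \<Phi> \<Psi>\<close> is the equation \<open>D(\<Phi> u) + \<Psi> u = 0\<close> without the normalizations of an
  admissible pair.\<close>

definition pearson :: "form \<Rightarrow> complex poly \<Rightarrow> complex poly \<Rightarrow> bool" where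
  "pearson u \<Phi> \<Psi> \<longleftrightarrow> (\<forall>f. u (\<Phi> * pderiv f) = u (\<Psi> * f))"

lemma pearsonD: "pearson u \<Phi> \<Psi> \<Longrightarrow> u (\<Phi> * pderiv f) = u (\<Psi> * f)"
  by (simp add: pearson_def)

lemma admissible_pair_iff_pearson:
  "admissible_pair u \<Phi> \<Psi> \<longleftrightarrow> lead_coeff \<Phi> = 1 \<and> degree \<Psi> \<ge> 1 \<and> pearson u \<Phi> \<Psi>"
  unfolding admissible_pair_def pearson_def form_D_def form_mult_def
  by (auto simp: add_eq_0_iff)

context
  fixes u :: form and B :: "nat \<Rightarrow> complex poly"
  assumes mo: "monic_orthogonal u B"
begin

lemmas u_simps = is_form_simps[OF monic_orthogonal_simps(1)[OF mo]]

lemma nondegenerate: "(\<And>f. u (g * f) = 0) \<Longrightarrow> g = 0"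
  using monic_orthogonal_nondegenerate[OF mo] by blast

lemma nondegenerate_eq: "(\<And>f. u (g * f) = u (h * f)) \<Longrightarrow> g = h"
  using nondegenerate[of "g - h"] by (simp add: left_diff_distrib u_simps)

lemma pearson_unique: "pearson u \<Phi> \<Psi> \<Longrightarrow> pearson u \<Phi> \<Psi>' \<Longrightarrow> \<Psi> = \<Psi>'"
  by (rule nondegenerate_eq) (simp add: pearson_def)

lemma pearson_diff: "pearson u \<Phi> \<Psi> \<Longrightarrow> pearson u \<Phi>' \<Psi>' \<Longrightarrow> pearson u (\<Phi> - \<Phi>') (\<Psi> - \<Psi>')"
  by (simp add: pearson_def left_diff_distrib u_simps)

text \<open>The product rule D(K v) = K D v + K' v for v = \<Phi> u, obtained by testing the given
  equation on \<open>K * f\<close>.\<close>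

lemma pearson_mult:
  assumes "pearson u \<Phi> \<Psi>"
  shows "pearson u (K * \<Phi>) (K * \<Psi> - pderiv K * \<Phi>)"
  unfolding pearson_def
proof
  fix f
  have "K * \<Phi> * pderiv f = \<Phi> * pderiv (K * f) - pderiv K * \<Phi> * f"
    by (simp add: pderiv_mult algebra_simps)
  moreover have "(K * \<Psi> - pderiv K * \<Phi>) * f = \<Psi> * (K * f) - pderiv K * \<Phi> * f"
    by (simp add: algebra_simps)
  ultimately show "u (K * \<Phi> * pderiv f) = u ((K * \<Psi> - pderiv K * \<Phi>) * f)"
    using pearsonD[OF assms, of "K * f"] by (simp only: u_simps)
qed

lemma pearson_smult: "pearson u (smult c \<Phi>) \<Psi> \<Longrightarrow> c \<noteq> 0 \<Longrightarrow> \<exists>\<Psi>'. pearson u \<Phi> \<Psi>'"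
  using pearson_mult[of "smult c \<Phi>" \<Psi> "[:1/c:]"] by auto

text \<open>The polynomials \<open>\<Phi>\<close> of the Pearson equations of \<open>u\<close> form an ideal. The hypothesis on
  divisibility says that \<open>\<Phi>\<^sub>0\<close> generates it; multiplying the generator by \<open>K\<close> raises the class
  by the degree of \<open>K\<close>.\<close>

lemma form_class_eq:
  assumes adm: "admissible_pair u \<Phi>\<^sub>0 \<Psi>\<^sub>0" and deg: "degree \<Phi>\<^sub>0 \<le> degree \<Psi>\<^sub>0"
    and dvd: "\<And>\<Phi> \<Psi>. admissible_pair u \<Phi> \<Psi> \<Longrightarrow> \<Phi>\<^sub>0 dvd \<Phi>"
  shows "form_class u = degree \<Psi>\<^sub>0 - 1"
  unfolding form_class_def
proof (rule Least_equality)
  show "\<exists>\<Phi> \<Psi>. admissible_pair u \<Phi> \<Psi> \<and> degree \<Psi>\<^sub>0 - 1 = max (degree \<Phi> - 2) (degree \<Psi> - 1)"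
    using adm deg by (intro exI[of _ \<Phi>\<^sub>0] exI[of _ \<Psi>\<^sub>0]) auto
next
  fix s
  assume "\<exists>\<Phi> \<Psi>. admissible_pair u \<Phi> \<Psi> \<and> s = max (degree \<Phi> - 2) (degree \<Psi> - 1)"
  \<comment> \<open>Keeping only the part of the maximum from \<Psi> is enough, since it already
    reaches the claimed bound.\<close>
  then obtain \<Phi> \<Psi> where \<Phi>: "admissible_pair u \<Phi> \<Psi>" and s: "s \<ge> degree \<Psi> - 1"
    by auto
  obtain K where K: "\<Phi> = K * \<Phi>\<^sub>0"
    using dvd[OF \<Phi>] by (metis dvdE mult.commute)
  have nz: "K \<noteq> 0" "\<Psi>\<^sub>0 \<noteq> 0" "\<Phi>\<^sub>0 \<noteq> 0"
    using \<Phi> adm K by (auto simp: admissible_pair_iff_pearson)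
  have \<Psi>: "\<Psi> = K * \<Psi>\<^sub>0 - pderiv K * \<Phi>\<^sub>0"
    using \<Phi> adm pearson_mult[of \<Phi>\<^sub>0 \<Psi>\<^sub>0 K] K
    by (auto simp: admissible_pair_iff_pearson intro: pearson_unique)
  have "degree \<Psi> = degree (K * \<Psi>\<^sub>0)"
  proof (cases "pderiv K = 0")
    case False
    then have "degree K \<noteq> 0"
      by (auto simp: pderiv_eq_0_iff)
    \<comment> \<open>Differentiation lowers the degree of \<open>K\<close>, and the generator has
      degree at most that of its partner, so no leading terms cancel.\<close>
    then have "degree (- (pderiv K * \<Phi>\<^sub>0)) < degree (K * \<Psi>\<^sub>0)"
      using nz False deg by (simp add: degree_mult_eq degree_pderiv)
    then show ?thesis
      unfolding \<Psi> using degree_add_eq_left[of "- (pderiv K * \<Phi>\<^sub>0)" "K * \<Psi>\<^sub>0"] by simp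
  qed (simp add: \<Psi>)
  then show "degree \<Psi>\<^sub>0 - 1 \<le> s"
    using s nz by (simp add: degree_mult_eq)
qed

section \<open>From two transposed equations to a Riccati equation\<close>

text \<open>The commutator of the operator with multiplication by x is -2 x^2 d/dx - (2\<alpha> + 3)
  x. Testing it with \<open>u\<close> turns the two hypotheses into a first-order equation;
  \<open>G\<close> is half of the resulting polynomial.\<close>

lemma pearson_of_first_two:
  assumes 0: "\<And>f. u (KL_operator \<alpha> f) = u (P * f)"
    and 1: "\<And>f. u (X * KL_operator \<alpha> f) = u (Q * f)"
  shows "\<exists>G. pearson u (X\<^sup>2) G"
proof -
  define x c c' where "x = X" and "c = [:complex_of_real (2 * \<alpha> + 3):]"
    and "c' = [:complex_of_real ((\<alpha> + 1)\<^sup>2):]"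
  have px: "pderiv x = 1" by (simp add: x_def pderiv_pCons)
  have L: "KL_operator \<alpha> f = - (x\<^sup>2 * pderiv (pderiv f)) - c * (x * pderiv f) + (x - c') * f" for f
    by (simp only: KL_operator_def x_def c_def c'_def)
  have comm: "KL_operator \<alpha> (x * f) - x * KL_operator \<alpha> f =
      - (x\<^sup>2 * pderiv f) - (x\<^sup>2 * pderiv f) - c * x * f" for f
    unfolding L pderiv_mult pderiv_add px
    by (simp add: algebra_simps power2_eq_square px)
  have "u (x\<^sup>2 * pderiv f) + u (x\<^sup>2 * pderiv f) = u ((Q - P * x - c * x) * f)" for f
  proof -
    have "u (KL_operator \<alpha> (x * f)) - u (x * KL_operator \<alpha> f) = u (P * (x * f)) - u (Q * f)"
      using 0 1 x_def by simp
    moreover have "u (KL_operator \<alpha> (x * f)) - u (x * KL_operator \<alpha> f) =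
      - u (x\<^sup>2 * pderiv f) - u (x\<^sup>2 * pderiv f) - u (c * x * f)"
      using arg_cong[OF comm[of f], where f = u] by (simp only: u_simps)
    ultimately have "- u (x\<^sup>2 * pderiv f) - u (x\<^sup>2 * pderiv f) - u (c * x * f) =
        u (P * (x * f)) - u (Q * f)"
      by simp
    then have "u (x\<^sup>2 * pderiv f) + u (x\<^sup>2 * pderiv f) =
        u (Q * f) - u (P * (x * f)) - u (c * x * f)"
      by algebra
    moreover have "(Q - P * x - c * x) * f = Q * f - P * (x * f) - c * x * f"
      by (simp add: algebra_simps)
    ultimately show ?thesis
      by (simp only: u_simps)
  qed
  then have "pearson u (x\<^sup>2) (smult (1/2) (Q - P * x - c * x))"
    by (simp add: pearson_def u_simps) (simp add: field_simps)
  then show ?thesis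
    unfolding x_def by blast
qed

text \<open>On test functions x^2 f every derivative can be moved by the Pearson equation.
  Cancelling \<open>u\<close> leaves a polynomial identity that is divisible by x^2.\<close>

lemma riccati:
  assumes 0: "\<And>f. u (KL_operator \<alpha> f) = u (P * f)"
    and G: "pearson u (X\<^sup>2) G"
  shows "\<exists>q. G = X * q \<and> P = - (q\<^sup>2) + X * pderiv q - q
      - [:of_real (2 * \<alpha> + 3):] * (q + 1) + X - [:of_real ((\<alpha> + 1)\<^sup>2):]"
proof -
  define x c c' where "x = X" and "c = [:complex_of_real (2 * \<alpha> + 3):]"
    and "c' = [:complex_of_real ((\<alpha> + 1)\<^sup>2):]"
  have px: "pderiv x = 1" by (simp add: x_def pderiv_pCons)
  have L: "KL_operator \<alpha> f = - (x\<^sup>2 * pderiv (pderiv f)) - c * (x * pderiv f) + (x - c') * f" for f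
    by (simp only: KL_operator_def x_def c_def c'_def)
  have G': "u (x\<^sup>2 * pderiv f) = u (G * f)" for f
    using pearsonD[OF G] by (simp only: x_def)
  have px2: "pderiv (x\<^sup>2) = 2 * x"
    by (simp add: power2_eq_square pderiv_mult px)
  have p2: "pderiv (x\<^sup>2 * f) = x * f + x * f + x\<^sup>2 * pderiv f" for f
    by (simp add: pderiv_mult px power2_eq_square algebra_simps)
  have first: "u (c * (x * pderiv (x\<^sup>2 * f))) = u (c * (x\<^sup>2 + x * G) * f)" for f
  proof -
    have "c * (x * pderiv (x\<^sup>2 * f)) = x\<^sup>2 * pderiv (c * x * f) + c * x\<^sup>2 * f"
      unfolding p2 by (simp add: pderiv_mult px c_def pderiv_pCons power2_eq_square algebra_simps
          del: mult_pCons_left mult_pCons_right)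
    then have "u (c * (x * pderiv (x\<^sup>2 * f))) = u (G * (c * x * f)) + u (c * x\<^sup>2 * f)"
      by (simp only: u_simps G')
    then show ?thesis
      by (simp add: u_simps algebra_simps)
  qed
  \<comment> \<open>The Pearson equation is used twice: for the derivative of x^2 f, then, after the
    product rule, for G f.\<close>
  have second: "u (x\<^sup>2 * pderiv (pderiv (x\<^sup>2 * f))) =
      u ((x * G + x * G + G\<^sup>2 - x\<^sup>2 * pderiv G) * f)" for f
  proof -
    have "u (x\<^sup>2 * pderiv (pderiv (x\<^sup>2 * f))) = u (G * pderiv (x\<^sup>2 * f))"
      by (rule G')
    also have "G * pderiv (x\<^sup>2 * f) =
        x * G * f + x * G * f + x\<^sup>2 * pderiv (G * f) - x\<^sup>2 * pderiv G * f"
      unfolding p2 pderiv_mult px2 by (simp add: algebra_simps)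
    also have "u \<dots> = u (x * G * f + x * G * f + G * (G * f) - x\<^sup>2 * pderiv G * f)"
      by (simp only: u_simps G')
    also have "x * G * f + x * G * f + G * (G * f) - x\<^sup>2 * pderiv G * f =
        (x * G + x * G + G\<^sup>2 - x\<^sup>2 * pderiv G) * f"
      by (simp add: algebra_simps power2_eq_square)
    finally show ?thesis .
  qed
  have eq: "- (x * G + x * G + G\<^sup>2 - x\<^sup>2 * pderiv G) - c * (x\<^sup>2 + x * G) + (x - c') * x\<^sup>2 = P * x\<^sup>2"
  proof (rule nondegenerate_eq)
    fix f
    have "u (P * x\<^sup>2 * f) = u (KL_operator \<alpha> (x\<^sup>2 * f))"
      using 0[of "x\<^sup>2 * f"] by (simp add: mult.assoc)
    also have "\<dots> = - u ((x * G + x * G + G\<^sup>2 - x\<^sup>2 * pderiv G) * f)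
        - u (c * (x\<^sup>2 + x * G) * f) + u ((x - c') * (x\<^sup>2 * f))"
      unfolding L by (simp only: u_simps first second)
    finally show "u ((- (x * G + x * G + G\<^sup>2 - x\<^sup>2 * pderiv G) - c * (x\<^sup>2 + x * G) + (x - c') * x\<^sup>2) * f)
        = u (P * x\<^sup>2 * f)"
      by (simp add: u_simps algebra_simps)
  qed
  \<comment> \<open>At 0 only the square of \<open>G\<close> survives in \<open>eq\<close>.\<close>
  have "poly G 0 = 0"
    using arg_cong[OF eq, of "\<lambda>p. poly p 0"] by (simp add: x_def)
  then have "x dvd G"
    by (simp add: x_def poly_eq_0_iff_dvd)
  then obtain q where q: "G = x * q" ..
  have "x\<^sup>2 * P = x\<^sup>2 * (- (q\<^sup>2) + x * pderiv q - q - c * (q + 1) + x - c')"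
    using eq unfolding q by (simp add: pderiv_mult px algebra_simps power2_eq_square)
  moreover have "x\<^sup>2 \<noteq> 0" by (simp add: x_def)
  ultimately have "P = - (q\<^sup>2) + x * pderiv q - q - c * (q + 1) + x - c'"
    by (metis mult_left_cancel)
  then show ?thesis
    using q unfolding x_def c_def c'_def by blast
qed

text \<open>If \<open>q\<close> is constant, then \<open>n u(x\<^sup>n\<^sup>+\<^sup>1) = c u(x\<^sup>n\<^sup>+\<^sup>1)\<close>, so almost all moments vanish.\<close>

lemma pearson_X2_degree:
  assumes "pearson u (X\<^sup>2) (X * q)"
  shows "degree q \<ge> 1"
proof (rule ccontr)
  assume "\<not> degree q \<ge> 1"
  then obtain c where c: "q = [:c:]"
    by (auto elim: degree_eq_zeroE simp: not_less_eq_eq)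
  have moment: "(of_nat n - c) * u (X ^ Suc n) = 0" for n
  proof -
    have "X\<^sup>2 * pderiv (X ^ n) = smult (of_nat n) (X ^ Suc n)"
    proof (cases n)
      case (Suc m)
      have "pderiv (X ^ Suc m) = smult (of_nat (Suc m)) (X ^ m)"
        unfolding pderiv_power_Suc by (simp add: pderiv_pCons)
      then show ?thesis
        unfolding Suc by (simp only: mult_smult_right power2_eq_square power_Suc mult.assoc)
    qed simp
    then have "of_nat n * u (X ^ Suc n) = u (X * q * X ^ n)"
      using pearsonD[OF assms, of "X ^ n"] by (simp only: u_simps)
    also have "X * q * X ^ n = smult c (X ^ Suc n)"
      by (simp add: c)
    finally show ?thesis by (simp only: u_simps left_diff_distrib diff_self)
  qed
  obtain M :: nat where M: "real M > cmod c"
    using reals_Archimedean2 by blast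
  have zero: "u (X ^ Suc n) = 0" if "n \<ge> M" for n
  proof -
    have "of_nat n \<noteq> c"
      using M that by auto
    then show ?thesis using moment[of n] by simp
  qed
  \<comment> \<open>All moments from order M + 1 on vanish, so this power of \<open>X\<close>
    annihilates \<open>u\<close>, against regularity.\<close>
  have "u (X ^ Suc M * f) = 0" for f
  proof -
    have "X ^ Suc M * f = (\<Sum>i\<le>degree f. smult (coeff f i) (X ^ Suc (M + i)))"
      by (subst (1) poly_as_sum_of_monoms[symmetric])
        (simp add: sum_distrib_left monom_altdef power_add mult_ac
          del: mult_pCons_left mult_pCons_right)
    then show ?thesis
      by (simp add: u_simps zero del: power_Suc)
  qed
  then have "X ^ Suc M = 0"
    by (rule nondegenerate)
  then show False by simp
qed

text \<open>By the Leibniz rule, moving \<open>b\<close> inside the operator costs only terms of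
  order at most one, which \<open>P\<close> and \<open>G\<close> handle; regularity then determines
  \<open>R\<close>. With \<open>b = B n\<close> this is the source of the second-order
  equation.\<close>

lemma structure_polynomial:
  assumes 0: "\<And>f. u (KL_operator \<alpha> f) = u (P * f)"
    and G: "pearson u (X\<^sup>2) G"
    and R: "\<And>f. u (b * KL_operator \<alpha> f) = u (R * f)"
  shows "R = P * b - X\<^sup>2 * pderiv (pderiv b) + (G * pderiv b + G * pderiv b)
      + [:of_real (2 * \<alpha> + 3):] * (X * pderiv b)"
proof -
  define x c c' where "x = X" and "c = [:complex_of_real (2 * \<alpha> + 3):]"
    and "c' = [:complex_of_real ((\<alpha> + 1)\<^sup>2):]"
  have L: "KL_operator \<alpha> f = - (x\<^sup>2 * pderiv (pderiv f)) - c * (x * pderiv f) + (x - c') * f" for f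
    by (simp only: KL_operator_def x_def c_def c'_def)
  have G': "u (x\<^sup>2 * pderiv f) = u (G * f)" for f
    using pearsonD[OF G] by (simp only: x_def)
  have "u (R * f) = u ((P * b - x\<^sup>2 * pderiv (pderiv b) + (G * pderiv b + G * pderiv b) + c * (x * pderiv b)) * f)" for f
  proof -
    \<comment> \<open>The mixed term 2 x^2 b' f' is completed to 2 x^2 (b' f)', the shape to which
      the Pearson equation applies.\<close>
    have "b * KL_operator \<alpha> f = KL_operator \<alpha> (b * f) + (x\<^sup>2 * pderiv (pderiv b * f) + x\<^sup>2 * pderiv (pderiv b * f)
        - x\<^sup>2 * pderiv (pderiv b) * f + c * (x * pderiv b) * f)"
      unfolding L pderiv_mult pderiv_add by (simp add: algebra_simps)
    moreover have "(P * b - x\<^sup>2 * pderiv (pderiv b) + (G * pderiv b + G * pderiv b)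
        + c * (x * pderiv b)) * f = P * (b * f) + (G * (pderiv b * f) + G * (pderiv b * f)
        - x\<^sup>2 * pderiv (pderiv b) * f + c * (x * pderiv b) * f)"
      by (simp add: algebra_simps)
    moreover have "u (R * f) = u (b * KL_operator \<alpha> f)"
      by (rule R[symmetric])
    ultimately show ?thesis
      by (simp only: u_simps 0 G')
  qed
  then show ?thesis
    unfolding x_def c_def by (rule nondegenerate_eq)
qed
text \<open>The functional \<open>E\<close> in the proof is the obstruction to cancelling \<open>x\<close> from
  \<open>D(x\<^sup>2 u) + x q u = 0\<close>: it vanishes on multiples of \<open>x\<close>, so it is a multiple of evaluation at 0.\<close>

lemma pearson_trichotomy:
  assumes u1: "u 1 = 1" and G: "pearson u (X\<^sup>2) (X * q)" and q: "degree q \<ge> 1"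
    and trace: "u (q\<^sup>2 - X * pderiv q + q + [:c:] * (q + 1)) = 0"
  obtains (a) "u q \<noteq> - 1" "poly q 0 = - c" "form_class u = degree q"
  | (b) "u q = - 1" "pearson u X (q + 1)" "form_class u = degree q - 1"
  | (c) h where "q + 2 = X * h" "pearson u 1 h" "degree q \<ge> 2" "form_class u = degree q - 2"
proof -
  define E where "E = (\<lambda>f. u (X * pderiv f) - u ((q + 1) * f))"
  have EX: "E (X * f) = 0" for f
  proof -
    have "X * pderiv (X * f) - (q + 1) * (X * f) = X\<^sup>2 * pderiv f - X * q * f"
      unfolding pderiv_mult by (simp add: pderiv_pCons power2_eq_square algebra_simps
          del: mult_pCons_left mult_pCons_right)
    then have "E (X * f) = u (X\<^sup>2 * pderiv f - X * q * f)"
      by (simp only: E_def flip: u_simps(2))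
    then show ?thesis
      using pearsonD[OF G, of f] by (simp only: u_simps diff_self)
  qed
  have Eadd: "E (f + g) = E f + E g" for f g
    by (simp only: E_def pderiv_add distrib_left u_simps) simp
  have Ef: "E f = poly f 0 * E 1" for f
  proof -
    obtain c0 g where f: "f = pCons c0 g" by (cases f)
    have "f = smult c0 1 + X * g" by (simp add: f)
    then have "E f = E (smult c0 1) + E (X * g)" using Eadd by metis
    also have "E (smult c0 1) = c0 * E 1"
      by (simp only: E_def pderiv_smult mult_smult_right u_simps right_diff_distrib)
    finally show ?thesis
      using EX f by simp
  qed
  have E1: "E 1 = - (u q + 1)"
    using u1 by (simp add: E_def u_simps)
  have E_pearson: "E 1 = 0 \<longleftrightarrow> pearson u X (q + 1)"
    using Ef unfolding E_def pearson_def by (metis eq_iff_diff_eq_0 mult_zero_right)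
  have degq1: "degree (q + 1) = degree q"
    using q by (intro degree_add_eq_left) simp
  have deg_Xq: "degree (X * q) = Suc (degree q)"
    using q by (subst degree_mult_eq) auto
  have X2: "admissible_pair u (X\<^sup>2) (X * q)"
    using G deg_Xq by (simp add: admissible_pair_iff_pearson lead_coeff_power)
  show ?thesis
  proof (cases "E 1 = 0")
    case False
    \<comment> \<open>Multiplying by \<open>X\<close> and comparing with the equation for x^2 forces
      \<open>h = q + 1\<close>, hence \<open>E 1 = 0\<close>.\<close>
    have noX: "\<not> pearson u X h" for h
    proof
      assume h: "pearson u X h"
      have "pearson u (X\<^sup>2) (X * h - X)"
        using pearson_mult[OF h, of X] by (simp add: power2_eq_square pderiv_pCons)
      then have "X * q = X * h - X"
        using G by (rule pearson_unique[rotated])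
      then have "X * h = X * (q + 1)"
        by (simp add: distrib_left del: mult_pCons_left)
      then have "h = q + 1"
        by (metis mult_left_cancel pCons_eq_0_iff zero_neq_one)
      with h False E_pearson show False by simp
    qed
    have "form_class u = degree (X * q) - 1"
    proof (rule form_class_eq[OF X2])
      show "degree (X\<^sup>2) \<le> degree (X * q)"
        using q deg_Xq by (simp add: degree_power_eq)
      fix \<Phi> \<Psi> assume "admissible_pair u \<Phi> \<Psi>"
      then have \<Phi>: "pearson u \<Phi> \<Psi>" by (simp add: admissible_pair_iff_pearson)
      \<comment> \<open>The remainder of \<Phi> modulo x^2 again satisfies a Pearson equation, so it
        has to be shown zero.\<close>
      obtain a0 a1 r where r: "\<Phi> = pCons a0 (pCons a1 r)"
        by (metis pCons_cases)
      have r': "\<Phi> - r * X\<^sup>2 = [:a0, a1:]"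
        by (simp add: r power2_eq_square)
      have low: "pearson u [:a0, a1:] (\<Psi> - (r * (X * q) - pderiv r * X\<^sup>2))"
        using pearson_diff[OF \<Phi> pearson_mult[OF G, of r]] unfolding r' .
      have "a0 = 0"
      proof (rule ccontr)
        assume "a0 \<noteq> 0"
        \<comment> \<open>Multiplying the remainder by \<open>X\<close> and reducing modulo x^2
          would put a nonzero multiple of \<open>X\<close> into the ideal.\<close>
        have "X * [:a0, a1:] - [:a1:] * X\<^sup>2 = smult a0 X"
          by (simp add: power2_eq_square)
        then have "\<exists>h. pearson u (smult a0 X) h"
          using pearson_diff[OF pearson_mult[OF low, of X] pearson_mult[OF G, of "[:a1:]"]] by metis
        then show False
          using pearson_smult \<open>a0 \<noteq> 0\<close> noX by metis
      qed
      moreover have "a1 = 0"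
      proof (rule ccontr)
        assume "a1 \<noteq> 0"
        moreover have "[:a0, a1:] = smult a1 X" using \<open>a0 = 0\<close> by simp
        ultimately show False
          using low pearson_smult noX by metis
      qed
      ultimately have "\<Phi> = r * X\<^sup>2" using r' by simp
      then show "X\<^sup>2 dvd \<Phi>" by (simp only: dvd_triv_right)
    qed
    moreover have "poly q 0 = - c"
    proof -
      \<comment> \<open>\<open>E q\<close> is computed in two ways: evaluation at 0 gives q(0) E(1),
        and the hypothesis \<open>trace\<close> gives -c E(1).\<close>
      have "u (X * pderiv q) - u ((q + 1) * q) = poly q 0 * E 1"
        using Ef[of q] by (simp only: E_def)
      moreover have "u (q\<^sup>2) - u (X * pderiv q) + u q + c * (u q + 1) = 0"
        using trace u1 by (simp add: u_simps)
      moreover have "u ((q + 1) * q) = u (q\<^sup>2) + u q"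
        by (simp add: u_simps distrib_right power2_eq_square)
      ultimately have "(poly q 0 + c) * E 1 = 0"
        using E1 by algebra
      then show ?thesis
        using False by (simp add: eq_neg_iff_add_eq_0)
    qed
    ultimately show ?thesis
      using False E1 deg_Xq by (intro a) auto
  next
    case True
    then have X1: "pearson u X (q + 1)" and uq: "u q = - 1"
      using E_pearson E1 by (auto simp: eq_neg_iff_add_eq_0 simp del: minus_add_distrib)
    show ?thesis
    proof (cases "\<exists>h. pearson u 1 h")
      case True
      then obtain h where h: "pearson u 1 h" by blast
      have "pearson u X (X * h - 1)"
        using pearson_mult[OF h, of X] by (simp add: pderiv_pCons one_pCons)
      then have "q + 1 = X * h - 1"
        using X1 by (rule pearson_unique[rotated])
      then have qh: "q + 2 = X * h"
        by (simp add: algebra_simps del: mult_pCons_left mult_pCons_right)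
      have deg: "degree (q + 2) = degree q"
        using q by (intro degree_add_eq_left) simp
      have "h \<noteq> 0"
        using qh deg q by auto
      then have dh: "degree q = Suc (degree h)"
        using deg unfolding qh by (subst (asm) degree_mult_eq) auto
      \<comment> \<open>Testing with the constant 1 gives \<open>u h = 0\<close>, impossible for a
        nonzero constant \<open>h\<close> because \<open>u 1 = 1\<close>.\<close>
      have h1: "degree h \<ge> 1"
      proof (rule ccontr)
        assume "\<not> degree h \<ge> 1"
        then obtain c where "h = [:c:]"
          by (auto elim: degree_eq_zeroE simp: not_less_eq_eq)
        moreover have "u h = 0"
          using pearsonD[OF h, of 1] by (simp add: u_simps)
        ultimately have "c * u 1 = 0"
          by (simp add: one_pCons flip: u_simps(4))
        then show False
          using u1 \<open>h \<noteq> 0\<close> \<open>h = [:c:]\<close> by simp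
      qed
      have "form_class u = degree h - 1"
        by (rule form_class_eq) (use h h1 in \<open>auto simp: admissible_pair_iff_pearson\<close>)
      then show ?thesis
        using qh h h1 dh by (intro c) auto
    next
      case False
      have "form_class u = degree (q + 1) - 1"
      proof (rule form_class_eq)
        show "admissible_pair u X (q + 1)"
          using X1 q degq1 by (simp add: admissible_pair_iff_pearson)
        show "degree X \<le> degree (q + 1)"
          using q degq1 by simp
        fix \<Phi> \<Psi> assume "admissible_pair u \<Phi> \<Psi>"
        then have \<Phi>: "pearson u \<Phi> \<Psi>" by (simp add: admissible_pair_iff_pearson)
        obtain a0 r where r: "\<Phi> = pCons a0 r"
          by (metis pCons_cases)
        have r': "\<Phi> - r * X = smult a0 1"
          by (simp add: r one_pCons)
        have low: "\<exists>h. pearson u (smult a0 1) h"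
          using pearson_diff[OF \<Phi> pearson_mult[OF X1, of r]] unfolding r' by blast
        have "a0 = 0"
          using low pearson_smult False by metis
        then have "\<Phi> = r * X" using r by simp
        then show "X dvd \<Phi>" by (simp only: dvd_triv_right)
      qed
      then show ?thesis
        using X1 uq degq1 by (intro b) auto
    qed
  qed
qed

end

section \<open>Degrees and the structure relation\<close>

text \<open>The top coefficient is that of \<open>B d\<close>: a quotient of nonzero norms times the
  nonvanishing last recurrence coefficient.\<close>

lemma degree_structure_polynomial_0:
  assumes B: "monic_orthogonal u B" and d: "d \<ge> 1" and a: "a 1 0 \<noteq> 0"
  shows "degree ((\<Sum>\<nu>\<in>{0 - 1..0 + d}. smult (rho_coeff \<alpha> u B \<gamma> \<zeta> a d 0 \<nu>) (B \<nu>))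
    - smult (of_real (\<alpha>\<^sup>2)) (B 0)) = d" (is "degree ?P = d")
proof (rule antisym)
  note o = monic_orthogonal_simps[OF B]
  let ?r = "rho_coeff \<alpha> u B \<gamma> \<zeta> a d 0"
  have deg: "degree (B m) = m" "coeff (B m) m = 1" for m
    using o(2) unfolding monic_sequence_def by metis+
  show "degree ?P \<le> d"
    by (intro degree_diff_le degree_sum_le order_trans[OF degree_smult_le]) (auto simp: deg)
  have "coeff ?P d = (\<Sum>\<nu>\<in>{0..d}. if \<nu> = d then ?r d else 0)"
  proof -
    have "(\<Sum>\<nu>\<in>{0..d}. ?r \<nu> * coeff (B \<nu>) d) = (\<Sum>\<nu>\<in>{0..d}. if \<nu> = d then ?r d else 0)"
      by (intro sum.cong) (auto simp: deg coeff_eq_0)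
    then show ?thesis
      using d by (simp add: coeff_sum coeff_eq_0 deg)
  qed
  also have "\<dots> = u (B 0 * B 0) / u (B d * B d) * a 1 0"
    using d by (simp add: rho_coeff_def power2_eq_square)
  finally have "coeff ?P d \<noteq> 0"
    using a o(4) by simp
  then show "d \<le> degree ?P"
    by (rule le_degree)
qed

text \<open>All terms other than the square have degree at most that of \<open>q\<close>, so nothing
  cancels its leading term.\<close>

lemma degree_riccati:
  fixes q :: "complex poly"
  assumes q: "degree q \<ge> 1"
  shows "degree (- (q\<^sup>2) + X * pderiv q - q - [:c:] * (q + 1) + X - [:c':]) = 2 * degree q"
proof -
  let ?R = "X * pderiv q - q - [:c:] * (q + 1) + X - [:c':]"
  have "degree ?R \<le> degree q"
  proof (intro degree_diff_le degree_add_le)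
    show "degree (X * pderiv q) \<le> degree q"
      using degree_mult_le[of X "pderiv q"] q by (simp add: degree_pderiv)
    show "degree ([:c:] * (q + 1)) \<le> degree q"
      using degree_mult_le[of "[:c:]" "q + 1"] degree_add_le[of q "degree q" 1] by simp
  qed (use q in auto)
  moreover have sq: "degree (- (q\<^sup>2)) = 2 * degree q"
    using q by (subst degree_minus, subst degree_power_eq) auto
  ultimately have "degree ?R < degree (- (q\<^sup>2))"
    using q by linarith
  then have "degree (- (q\<^sup>2) + ?R) = degree (- (q\<^sup>2))"
    by (rule degree_add_eq_left)
  moreover have "- (q\<^sup>2) + ?R = - (q\<^sup>2) + X * pderiv q - q - [:c:] * (q + 1) + X - [:c':]"
    by (simp add: algebra_simps)
  ultimately show ?thesis
    using sq by metis
qed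

text \<open>The structure equation depends on \<open>N\<close> and \<open>\<rho>\<close> only
  through their product, so the normalization is left open here.\<close>

lemma KL_semiclassical_core:
  assumes \<alpha>: "\<alpha> \<ge> 0" and B: "monic_orthogonal u B"
    and rec: "d_recurrence d (\<lambda>n. KL_poly \<alpha> (B n)) \<zeta> a" and d: "d \<ge> 1"
    and \<beta>: "three_term_recurrence B \<beta> \<gamma>"
    and \<gamma>: "\<And>n. u (B (Suc n) * B (Suc n)) = \<gamma> (Suc n) * u (B n * B n)"
  obtains q where "d = 2 * degree q" "degree q \<ge> 1" "pearson u (X\<^sup>2) (X * q)"
    "u (q\<^sup>2 - X * pderiv q + q + [:of_real (2 * \<alpha> + 3):] * (q + 1)) = 0"
    "\<And>N \<rho> n. smult N \<rho> = q + [:of_real (2 * \<alpha> + 3):] \<Longrightarrow>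
      structure_equation \<alpha> u B N \<rho> \<gamma> \<zeta> a d n"
proof -
  note o = monic_orthogonal_simps[OF B] and lin = is_form_simps[OF monic_orthogonal_simps(1)[OF B]]
  define P where "P = (\<lambda>n. (\<Sum>\<nu>\<in>{n - 1..n + d}. smult (rho_coeff \<alpha> u B \<gamma> \<zeta> a d n \<nu>) (B \<nu>))
        - smult (of_real (\<alpha>\<^sup>2)) (B n))"
  have P: "u (B n * KL_operator \<alpha> f) = u (P n * f)" for n f
    unfolding P_def by (rule form_KL_operator[OF B rec \<gamma>])
  have P0: "u (KL_operator \<alpha> f) = u (P 0 * f)" for f
    using P[of 0 f] monic_sequence_0[OF o(2)] by simp
  have P1: "u (X * KL_operator \<alpha> f) = u ((P 1 + smult (\<beta> 0) (P 0)) * f)" for f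
  proof -
    \<comment> \<open>\<open>X\<close> is the combination \<open>B 1\<close> + \<beta> 0, so the
      equations for n = 0 and n = 1 control the pairing with \<open>X\<close>.\<close>
    have "X * KL_operator \<alpha> f = B 1 * KL_operator \<alpha> f + smult (\<beta> 0) (KL_operator \<alpha> f)"
      using \<beta> by (simp add: three_term_recurrence_def algebra_simps)
    then have "u (X * KL_operator \<alpha> f) = u (P 1 * f) + \<beta> 0 * u (P 0 * f)"
      by (simp only: lin P P0)
    then show ?thesis
      by (simp only: distrib_right lin mult_smult_left)
  qed
  obtain G where G: "pearson u (X\<^sup>2) G"
    using pearson_of_first_two[OF B P0 P1] by blast
  obtain q where q: "G = X * q" "P 0 = - (q\<^sup>2) + X * pderiv q - q
      - [:of_real (2 * \<alpha> + 3):] * (q + 1) + X - [:of_real ((\<alpha> + 1)\<^sup>2):]"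
    using riccati[OF B P0 G] by blast
  have Gq: "pearson u (X\<^sup>2) (X * q)"
    using G q(1) by simp
  have deg: "degree q \<ge> 1"
    by (rule pearson_X2_degree[OF B Gq])
  have "degree (P 0) = d"
    unfolding P_def using degree_structure_polynomial_0[OF B d] rec
    by (force simp: d_recurrence_def)
  \<comment> \<open>The recurrence and the Riccati equation give two values for the degree of
    \<open>P 0\<close>.\<close>
  then have "d = 2 * degree q"
    using degree_riccati[OF deg] unfolding q(2) by metis
  moreover have "u (q\<^sup>2 - X * pderiv q + q + [:of_real (2 * \<alpha> + 3):] * (q + 1)) = 0"
  proof -
    \<comment> \<open>The trace identity is the equation for n = 0 tested on the constant 1.\<close>
    have "KL_operator \<alpha> 1 = X - [:of_real ((\<alpha> + 1)\<^sup>2):]"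
      by (simp add: KL_operator_def)
    then have "u (X - [:of_real ((\<alpha> + 1)\<^sup>2):]) = u (P 0)"
      using P0[of 1] by simp
    moreover have "q\<^sup>2 - X * pderiv q + q + [:of_real (2 * \<alpha> + 3):] * (q + 1) =
        X - [:of_real ((\<alpha> + 1)\<^sup>2):] - P 0"
      unfolding q(2) by (simp add: algebra_simps)
    ultimately show ?thesis
      by (simp only: lin diff_self)
  qed
  moreover have "structure_equation \<alpha> u B N \<rho> \<gamma> \<zeta> a d n"
    if r: "smult N \<rho> = q + [:of_real (2 * \<alpha> + 3):]" for N \<rho> n
  proof -
    define x c where "x = X" and "c = [:complex_of_real (2 * \<alpha> + 3):]"
    have c: "[:complex_of_real (3 + 2 * \<alpha>):] = c" "[:complex_of_real (2 + 2 * \<alpha>):] = c - 1"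
      "[:complex_of_real (1 + 2 * \<alpha>):] = c - 2"
      by (simp_all add: c_def one_pCons numeral_poly algebra_simps)
    have c': "[:complex_of_real ((\<alpha> + 1)\<^sup>2):] = [:complex_of_real (\<alpha>\<^sup>2):] + c - 2"
      by (simp add: c_def numeral_poly power2_eq_square algebra_simps)
    have r': "smult N \<rho> = q + c" "smult (2 * N) \<rho> = q + c + (q + c)"
      using r unfolding c_def by (simp, metis mult_2 smult_add_left)
    have "smult N (X * pderiv \<rho>) = X * pderiv (smult N \<rho>)"
      by (simp only: pderiv_smult mult_smult_right)
    then have r'': "smult N (X * pderiv \<rho>) = X * pderiv q"
      unfolding r by (simp add: pderiv_add pderiv_pCons)
    have "P n = P 0 * B n - X\<^sup>2 * pderiv (pderiv (B n)) + (X * q * pderiv (B n) + X * q * pderiv (B n))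
      + c * (X * pderiv (B n))"
      unfolding c_def by (rule structure_polynomial[OF B P0 Gq P])
    moreover have "smult (of_real (\<alpha>\<^sup>2)) (B n) = [:of_real (\<alpha>\<^sup>2):] * B n"
      by simp
    ultimately have "(\<Sum>\<nu>\<in>{n - 1..n + d}. smult (rho_coeff \<alpha> u B \<gamma> \<zeta> a d n \<nu>) (B \<nu>)) =
      P 0 * B n - X\<^sup>2 * pderiv (pderiv (B n)) + (X * q * pderiv (B n) + X * q * pderiv (B n))
      + c * (X * pderiv (B n)) + [:of_real (\<alpha>\<^sup>2):] * B n"
      unfolding P_def by (simp only: eq_diff_eq diff_eq_eq)
    then show ?thesis
      unfolding structure_equation_def c r' r'' q(2)[folded c_def, unfolded c']
      unfolding x_def[symmetric]
      by (simp add: algebra_simps power2_eq_square)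
  qed
  ultimately show ?thesis
    using that deg Gq by blast
qed

section \<open>Normalization of the Pearson equation and the three cases\<close>

theorem theorem5p1:
  fixes \<alpha> :: real and d :: nat
    and u0 :: form and B S :: "nat \<Rightarrow> complex poly"
  assumes "\<alpha> \<ge> 0"
    and "monic_orthogonal u0 B" and "u0 1 = 1"
    and "\<And>n \<tau>. \<tau> > 0 \<Longrightarrow>
           poly (S n) (of_real (\<tau>\<^sup>2 / 4)) = KL \<alpha> (\<lambda>x. poly (B n) (of_real x)) \<tau>"
    and "d \<ge> 1" and "d_orthogonal d S"
  shows "even d \<and> d \<ge> 2 \<and> semiclassical u0 \<and>
    (\<exists>s. semiclassical_sequence B s \<and>
       int s \<in> {max 0 (int (d div 2) - 2), int (d div 2) - 1, int (d div 2)}) \<and>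
    (\<exists>N \<rho>. N \<noteq> 0 \<and> lead_coeff \<rho> = 1 \<and> degree \<rho> = d div 2 \<and>
       (\<exists>\<phi> \<psi>. admissible_pair u0 \<phi> \<psi> \<and>
          ((\<phi> = X\<^sup>2 \<and> \<psi> = X * (smult N \<rho> - [:of_real (3 + 2 * \<alpha>):]) \<and>
            poly \<rho> 0 = 0 \<and> u0 \<rho> \<noteq> inverse N * of_real (2 + 2 * \<alpha>) \<and>
            (\<forall>n::nat. \<alpha> \<noteq> - ((real n + 3) / 2)) \<and>
            form_class u0 = d div 2)
         \<or> (\<phi> = X \<and> \<psi> = smult N \<rho> - [:of_real (2 + 2 * \<alpha>):] \<and>
            u0 \<rho> = inverse N * of_real (2 + 2 * \<alpha>) \<and>
            (\<forall>n::nat. n \<ge> 1 \<longrightarrow> \<alpha> \<noteq> - (real n / 2) - 1) \<and>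
            int (form_class u0) = int (d div 2) - 1)
         \<or> (\<phi> = 1 \<and> \<psi> = smult N (theta 0 \<rho>) \<and>
            N * poly \<rho> 0 = of_real (1 + 2 * \<alpha>) \<and>
            (d \<ge> 4 \<longrightarrow> int (form_class u0) = int (d div 2) - 2)))) \<and>
       (\<exists>\<beta> \<gamma> \<zeta> a. three_term_recurrence B \<beta> \<gamma> \<and> d_recurrence d S \<zeta> a \<and>
          (\<forall>n. structure_equation \<alpha> u0 B N \<rho> \<gamma> \<zeta> a d n)))"
proof -
  note B = assms(2) and \<alpha> = assms(1)
  note lin = is_form_simps[OF monic_orthogonal_simps(1)[OF B]]
  have S: "S = (\<lambda>n. KL_poly \<alpha> (B n))"
    using KL_transformed_sequence[of \<alpha> S B] assms(1,4) by blast
  obtain \<zeta> a where rec: "d_recurrence d S \<zeta> a"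
    using d_orthogonal_recurrence[OF assms(6)] by blast
  obtain \<beta> \<gamma> where \<beta>: "three_term_recurrence B \<beta> \<gamma>"
      and \<gamma>: "\<And>n. u0 (B (Suc n) * B (Suc n)) = \<gamma> (Suc n) * u0 (B n * B n)"
    using monic_orthogonal_three_term[OF B] by blast
  define c where "c = complex_of_real (2 * \<alpha> + 3)"
  obtain q where d: "d = 2 * degree q" and q: "degree q \<ge> 1" and G: "pearson u0 (X\<^sup>2) (X * q)"
      and trace: "u0 (q\<^sup>2 - X * pderiv q + q + [:c:] * (q + 1)) = 0"
      and struct: "\<And>N \<rho> n. smult N \<rho> = q + [:c:] \<Longrightarrow> structure_equation \<alpha> u0 B N \<rho> \<gamma> \<zeta> a d n"
    using KL_semiclassical_core[OF \<alpha> B rec[unfolded S] assms(5) \<beta> \<gamma>] unfolding c_def by metis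
  \<comment> \<open>Adding the constant leaves the leading coefficient of \<open>q\<close>
    unchanged, so dividing by it makes \<open>\<rho>\<close> monic.\<close>
  define N \<rho> where "N = lead_coeff q" and "\<rho> = smult (inverse N) (q + [:c:])"
  have N: "N \<noteq> 0" using q by (auto simp: N_def)
  have N\<rho>: "smult N \<rho> = q + [:c:]" using N by (simp add: \<rho>_def)
  have deg: "degree (q + [:c:]) = degree q"
    using q by (intro degree_add_eq_left) simp
  have \<rho>: "degree \<rho> = d div 2" "lead_coeff \<rho> = 1"
  proof -
    show *: "degree \<rho> = d div 2"
      using N deg d by (simp add: \<rho>_def)
    have "coeff (q + [:c:]) (degree q) = N"
      using q by (simp add: N_def coeff_eq_0)
    then show "lead_coeff \<rho> = 1"
      using N d unfolding * by (simp add: \<rho>_def)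
  qed
  have u\<rho>: "u0 \<rho> = inverse N * (u0 q + c)"
    using assms(3) lin(4)[of c 1] by (simp add: \<rho>_def lin one_pCons)
  let ?D = "\<lambda>\<phi> \<psi>. (\<phi> = X\<^sup>2 \<and> \<psi> = X * (smult N \<rho> - [:of_real (3 + 2 * \<alpha>):]) \<and>
            poly \<rho> 0 = 0 \<and> u0 \<rho> \<noteq> inverse N * of_real (2 + 2 * \<alpha>) \<and>
            (\<forall>n::nat. \<alpha> \<noteq> - ((real n + 3) / 2)) \<and>
            form_class u0 = d div 2)
         \<or> (\<phi> = X \<and> \<psi> = smult N \<rho> - [:of_real (2 + 2 * \<alpha>):] \<and>
            u0 \<rho> = inverse N * of_real (2 + 2 * \<alpha>) \<and>
            (\<forall>n::nat. n \<ge> 1 \<longrightarrow> \<alpha> \<noteq> - (real n / 2) - 1) \<and>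
            int (form_class u0) = int (d div 2) - 1)
         \<or> (\<phi> = 1 \<and> \<psi> = smult N (theta 0 \<rho>) \<and>
            N * poly \<rho> 0 = of_real (1 + 2 * \<alpha>) \<and>
            (d \<ge> 4 \<longrightarrow> int (form_class u0) = int (d div 2) - 2))"
  have \<alpha>ne: "\<alpha> \<noteq> - ((real n + 3) / 2)" "\<alpha> \<noteq> - (real n / 2) - 1" for n
    using \<alpha> by (auto simp: field_simps)
  have main: "(\<exists>\<phi> \<psi>. admissible_pair u0 \<phi> \<psi> \<and> ?D \<phi> \<psi>) \<and>
      int (form_class u0) \<in> {max 0 (int (d div 2) - 2), int (d div 2) - 1, int (d div 2)}"
  proof -
    consider (a) "u0 q \<noteq> - 1" "poly q 0 = - c" "form_class u0 = degree q"
      | (b) "u0 q = - 1" "pearson u0 X (q + 1)" "form_class u0 = degree q - 1"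
      | (c) h where "q + 2 = X * h" "pearson u0 1 h" "degree q \<ge> 2" "form_class u0 = degree q - 2"
      by (rule pearson_trichotomy[OF B assms(3) G q trace])
    then show ?thesis
    proof cases
      case a
      have "admissible_pair u0 (X\<^sup>2) (X * q)"
        using G q degree_mult_eq[of X q]
        by (auto simp: admissible_pair_iff_pearson lead_coeff_power)
      \<comment> \<open>The value q(0) = -c says \<rho>(0) = 0, and since c - 1 = 2 + 2\<alpha> the
        condition \<open>u0 q \<noteq> - 1\<close> is the one on \<open>u0 \<rho>\<close>.\<close>
      moreover have "?D (X\<^sup>2) (X * q)"
        using a d \<alpha>ne N u\<rho> by (simp add: N\<rho>) (simp add: \<rho>_def c_def add_eq_0_iff)
      ultimately have "\<exists>\<phi> \<psi>. admissible_pair u0 \<phi> \<psi> \<and> ?D \<phi> \<psi>"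
        by (intro exI[of _ "X\<^sup>2"] exI[of _ "X * q"] conjI)
      moreover have "int (form_class u0) = int (d div 2)"
        using a d by simp
      ultimately show ?thesis
        by blast
    next
      case b
      have "degree (q + 1) = degree q"
        using q by (intro degree_add_eq_left) simp
      then have "admissible_pair u0 X (q + 1)"
        using b q by (simp add: admissible_pair_iff_pearson)
      moreover have "q + [:c:] - [:complex_of_real (2 + 2 * \<alpha>):] = q + 1"
        by (simp add: c_def one_pCons)
      then have "?D X (q + 1)"
        using b d q \<alpha>ne(2) u\<rho> by (simp only: N\<rho>) (auto simp: c_def of_nat_diff)
      ultimately have "\<exists>\<phi> \<psi>. admissible_pair u0 \<phi> \<psi> \<and> ?D \<phi> \<psi>"
        by (intro exI[of _ "X"] exI[of _ "q + 1"] conjI)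
      moreover have "int (form_class u0) = int (d div 2) - 1"
        using b d q by (simp add: of_nat_diff)
      ultimately show ?thesis
        by blast
    next
      case (c h)
      \<comment> \<open>Splitting off q + 2 = x h exposes the constant term c - 2 = 1 + 2\<alpha> of
        N \<rho>.\<close>
      have "q + [:c:] = (q + 2) + [:c - 2:]"
        by (simp add: numeral_poly)
      then have Xh: "smult N \<rho> = X * h + [:c - 2:]"
        unfolding N\<rho> c(1) .
      have "poly (smult N \<rho>) 0 = c - 2"
        unfolding Xh by simp
      then have 0: "N * poly \<rho> 0 = c - 2"
        by simp
      have "X * smult N (theta 0 \<rho>) = smult N (\<rho> - [:poly \<rho> 0:])"
      proof -
        have "X dvd \<rho> - [:poly \<rho> 0:]"
          using poly_eq_0_iff_dvd[of "\<rho> - [:poly \<rho> 0:]" 0] by simp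
        then have "X * theta 0 \<rho> = \<rho> - [:poly \<rho> 0:]"
          unfolding theta_def by (metis dvd_mult_div_cancel minus_zero)
        then show ?thesis by (metis mult_smult_right)
      qed
      also have "\<dots> = X * h"
        using Xh 0 by (simp add: smult_diff_right)
      finally have th: "smult N (theta 0 \<rho>) = h"
        by (metis mult_left_cancel pCons_eq_0_iff zero_neq_one)
      have "degree (q + 2) = degree q"
        using q by (intro degree_add_eq_left) simp
      then have "degree h \<ge> 1"
        using c q by (cases "h = 0") (auto simp: degree_mult_eq)
      then have "admissible_pair u0 1 h"
        using c by (simp add: admissible_pair_iff_pearson)
      moreover have "?D 1 h"
        using th 0 c d by (simp add: c_def of_nat_diff)
      ultimately have "\<exists>\<phi> \<psi>. admissible_pair u0 \<phi> \<psi> \<and> ?D \<phi> \<psi>"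
        by (intro exI[of _ "1"] exI[of _ "h"] conjI)
      \<comment> \<open>Here \<open>degree q \<ge> 2\<close>, so the truncated difference is exact
        and the maximum is attained by its second entry.\<close>
      moreover have "int (form_class u0) = max 0 (int (d div 2) - 2)"
        using c d by (simp add: of_nat_diff)
      ultimately show ?thesis
        by blast
    qed
  qed
  then have semi: "semiclassical u0"
    using B unfolding semiclassical_def regular_form_def by blast
  have even: "even d" "d \<ge> 2"
    using d q by auto
  have sequence: "\<exists>s. semiclassical_sequence B s \<and>
       int s \<in> {max 0 (int (d div 2) - 2), int (d div 2) - 1, int (d div 2)}"
    using main semi B unfolding semiclassical_sequence_def by blast
  have recurrences: "\<exists>\<beta> \<gamma> \<zeta> a. three_term_recurrence B \<beta> \<gamma> \<and> d_recurrence d S \<zeta> a \<and>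
          (\<forall>n. structure_equation \<alpha> u0 B N \<rho> \<gamma> \<zeta> a d n)"
    using \<beta> rec struct[OF N\<rho>] by blast
  show ?thesis
    by (intro conjI even semi sequence, rule exI[of _ N], rule exI[of _ \<rho>])
      (intro conjI N \<rho> main[THEN conjunct1] recurrences)
qed

end
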